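(* Let $D_\delta$ be a simply connected domain of hexagons in $\mathcal{H}_\delta$, let $a_\delta$ be a mid-edge lying outside $D_\delta$ but within distance $\delta/2$ of $\partial D_\delta$, and let $b_\delta$ be a mid-edge in $D_\delta$ such that the four hexagons within distance $\delta$ of $b_\delta$ all belong to $D_\delta$. Let $\gamma_\delta$ be the radial exploration process from $a_\delta$ to $b_\delta$ in $D_\delta$ and $\gamma'_\delta$ the radial exploration process from $b_\delta$ to $a_\delta$ in $D_\delta$. Then for any simple polygonal path $\omega$ from $a_\delta$ to $b_\delta$ (in $D_\delta$ together with the half-edge joining $a_\delta$ to $D_\delta$), $$P(\gamma_\delta=\omega)=P(\gamma'_\delta=\omega)=(1/2)^{l(\omega)},$$ where $\gamma'_\delta=\omega$ means that $\gamma'_\delta$ is the time-reversal of $\omega$, and $l(\omega)$ is the number of hexagons in $D_\delta$ sharing at least a half-edge with $\omega$.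
   Context: Lattice. $\mathcal{H}_\delta$ is the hexagonal lattice in $\mathbb{C}$ with mesh (edge length) $\delta$. A mid-edge is the centre of an edge of $\mathcal{H}_\delta$. Two distinct mid-edges are within distance $\delta$ of each other exactly when their edges share a vertex. $D_\delta$ is a connected set of hexagons, regarded as a closed set including its boundary edges. A polygonal path is a continuous path using only edges (and half-edges) of $\mathcal{H}_\delta$. Let $e_a$ denote the unique half-edge starting at $a_\delta$ and connected to $D_\delta$. Radial exploration process $\gamma_\delta$ from $a_\delta$ to $b_\delta$ in $D_\delta$. It is a random polygonal path with $\gamma_\delta(k)$ a mid-edge for integer $k$ and $\gamma_\delta(k-1/2)$ the lattice vertex traversed between $\gamma_\delta(k-1)$ and $\gamma_\delta(k)$. Set $\gamma_\delta(0)=a_\delta$ and $\gamma_\delta[0,1/2]=e_a$. Step 1: $\gamma_\delta(1)$ is one of the two mid-edges in $D_\delta$ within distance $\delta$ of $a_\delta$, each with probability $1/2$. Step $k\ge 2$: let $\gamma_\delta(k-1/2)$ be the endpoint, other than $\gamma_\delta(k-3/2)$, of the edge whose centre is $\gamma_\delta(k-1)$. A mid-edge $m\ne\gamma_\delta(k-1)$ of an edge incident to $\gamma_\delta(k-1/2)$ is called allowable if there is a polygonal path from $m$ to $b_\delta$ contained in $D_\delta$ that does not meet $\gamma_\delta[0,k-1/2]$. There are one or two allowable mid-edges; $\gamma_\delta(k)$ is chosen uniformly among them, independently of previous choices. The process stops on reaching $b_\delta$. Radial exploration process $\gamma'_\delta$ from $b_\delta$ to $a_\delta$ in $D_\delta$.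 Set $\gamma'_\delta(0)=b_\delta$; $\gamma'_\delta(1)$ is uniform among the 4 mid-edges within distance $\delta$ of $b_\delta$. Step $k\ge2$: with $\gamma'_\delta(k-1/2)$ the endpoint, other than $\gamma'_\delta(k-3/2)$, of the edge with centre $\gamma'_\delta(k-1)$, a mid-edge $m\neq\gamma'_\delta(k-1)$ of an edge incident to $\gamma'_\delta(k-1/2)$ is allowable if there is a polygonal path from $m$ to $a_\delta$ contained in $D_\delta\cup e_a$ that does not meet $\gamma'_\delta[0,k-1/2]$. There are one or two allowable mid-edges; $\gamma'_\delta(k)$ is chosen uniformly among them, independently of previous choices. The process stops on reaching $a_\delta$. *)

theory Defs
  imports "HOL-Probability.Probability" "HOL-Probability.SPMF"
begin

(* Hexagons are indexed by their position in the triangular lattice of centres. *)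

definition hex_center :: "real \<Rightarrow> int \<times> int \<Rightarrow> complex" where
  "hex_center \<delta> h = of_real (\<delta> * sqrt 3) * (of_int (fst h) + of_int (snd h) * cis (pi / 3))"

(* The index k is read modulo 6. *)
definition hex_corner :: "real \<Rightarrow> int \<times> int \<Rightarrow> nat \<Rightarrow> complex" where
  "hex_corner \<delta> h k = hex_center \<delta> h + of_real \<delta> * cis (pi / 6 + real k * (pi / 3))"

definition hexagon :: "real \<Rightarrow> int \<times> int \<Rightarrow> complex set" where
  "hexagon \<delta> h = convex hull (hex_corner \<delta> h ` {..<6})"

definition hex_region :: "real \<Rightarrow> (int \<times> int) set \<Rightarrow> complex set" where
  "hex_region \<delta> D = (\<Union>h\<in>D. hexagon \<delta> h)"

definition hex_adj :: "real \<Rightarrow> complex \<Rightarrow> complex \<Rightarrow> bool" where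
  "hex_adj \<delta> u v \<longleftrightarrow> (\<exists>h k. {u, v} = {hex_corner \<delta> h k, hex_corner \<delta> h (Suc k)})"

definition mid_edges :: "real \<Rightarrow> complex set" where
  "mid_edges \<delta> = {midpoint u v | u v. hex_adj \<delta> u v}"

(* v is an endpoint of the edge whose centre is m *)
definition endpoint :: "real \<Rightarrow> complex \<Rightarrow> complex \<Rightarrow> bool" where
  "endpoint \<delta> m v \<longleftrightarrow> (\<exists>w. hex_adj \<delta> v w \<and> m = midpoint v w)"

definition half_edge :: "real \<Rightarrow> complex \<Rightarrow> complex \<Rightarrow> bool" where
  "half_edge \<delta> x y \<longleftrightarrow> endpoint \<delta> x y \<or> endpoint \<delta> y x"

(* A polygonal path is given by the mid-edges and vertices it passes through, in order:
   p ! (2 * k) is its position at time k, and p ! (2 * k + 1) its position at time k + 1/2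
   (for a path that starts at a mid-edge). *)
definition polygonal_path :: "real \<Rightarrow> complex list \<Rightarrow> bool" where
  "polygonal_path \<delta> p \<longleftrightarrow> p \<noteq> [] \<and> successively (half_edge \<delta>) p"

definition simple_polygonal_path :: "real \<Rightarrow> complex list \<Rightarrow> bool" where
  "simple_polygonal_path \<delta> p \<longleftrightarrow> polygonal_path \<delta> p \<and> distinct p"

fun path_trace :: "complex list \<Rightarrow> complex set" where
  "path_trace [] = {}"
| "path_trace [x] = {x}"
| "path_trace (x # y # p) = closed_segment x y \<union> path_trace (y # p)"

definition other_endpoint :: "real \<Rightarrow> complex \<Rightarrow> complex \<Rightarrow> complex" where
  "other_endpoint \<delta> m u = (THE v. endpoint \<delta> m v \<and> v \<noteq> u)"

definition common_endpoint :: "real \<Rightarrow> complex \<Rightarrow> complex \<Rightarrow> complex" where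
  "common_endpoint \<delta> m n = (THE v. endpoint \<delta> m v \<and> endpoint \<delta> n v)"

(* The half-edge e_a joins a to this vertex. *)
definition entry_vertex :: "real \<Rightarrow> (int \<times> int) set \<Rightarrow> complex \<Rightarrow> complex" where
  "entry_vertex \<delta> D a = (THE v. endpoint \<delta> a v \<and> v \<in> hex_region \<delta> D)"

definition entry_half_edge :: "real \<Rightarrow> (int \<times> int) set \<Rightarrow> complex \<Rightarrow> complex set" where
  "entry_half_edge \<delta> D a = closed_segment a (entry_vertex \<delta> D a)"

(* R is the set in which connecting paths must stay, t the target, p the positions at times
   0, 1/2, ..., k - 1, and v the position at time k - 1/2. *)
definition allowable ::
  "real \<Rightarrow> complex set \<Rightarrow> complex \<Rightarrow> complex list \<Rightarrow> complex \<Rightarrow> complex set" where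
  "allowable \<delta> R t p v =
     {m. endpoint \<delta> m v \<and> m \<noteq> last p \<and>
         (\<exists>q. polygonal_path \<delta> q \<and> hd q = m \<and> last q = t \<and>
              path_trace q \<subseteq> R \<and> path_trace q \<inter> path_trace (p @ [v]) = {})}"

(* Law of the completed path, given its initial part p. Missing mass is the probability that
   the target is never reached. *)
partial_function (spmf) explore ::
  "real \<Rightarrow> complex set \<Rightarrow> complex \<Rightarrow> complex list \<Rightarrow> complex list spmf" where
  "explore \<delta> R t p =
     (if last p = t then return_spmf p
      else let v = other_endpoint \<delta> (last p) (last (butlast p)) in
        bind_spmf (spmf_of_set (allowable \<delta> R t p v)) (\<lambda>m. explore \<delta> R t (p @ [v, m])))"

definition radial_exploration ::
  "real \<Rightarrow> (int \<times> int) set \<Rightarrow> complex \<Rightarrow> complex \<Rightarrow> complex list spmf" where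
  "radial_exploration \<delta> D a b =
     bind_spmf (spmf_of_set {m \<in> mid_edges \<delta>. m \<in> hex_region \<delta> D \<and> dist m a \<le> \<delta>})
       (\<lambda>m. explore \<delta> (hex_region \<delta> D) b [a, entry_vertex \<delta> D a, m])"

definition reverse_radial_exploration ::
  "real \<Rightarrow> (int \<times> int) set \<Rightarrow> complex \<Rightarrow> complex \<Rightarrow> complex list spmf" where
  "reverse_radial_exploration \<delta> D a b =
     bind_spmf (spmf_of_set {m \<in> mid_edges \<delta>. m \<noteq> b \<and> dist m b \<le> \<delta>})
       (\<lambda>m. explore \<delta> (hex_region \<delta> D \<union> entry_half_edge \<delta> D a) a
              [b, common_endpoint \<delta> b m, m])"

definition touched_hexagons ::
  "real \<Rightarrow> (int \<times> int) set \<Rightarrow> complex list \<Rightarrow> (int \<times> int) set" where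
  "touched_hexagons \<delta> D p =
     {h \<in> D. \<exists>x y. half_edge \<delta> x y \<and> closed_segment x y \<subseteq> hexagon \<delta> h \<inter> path_trace p}"

end

theory Submission
  imports Defs "HOL-Complex_Analysis.Complex_Analysis"
begin

text \<open>
  Let \<open>F\<close> be the hexagon ahead of the path when it arrives at a vertex \<open>v\<close>, and regard the whole complement
  of the domain as one additional hexagon. If no vertex visited before \<open>v\<close> lies on \<open>F\<close>, both mid-edges ahead
  are allowable: they are joined by a path around \<open>F\<close> (or, if \<open>F\<close> is outside, around the union of all
  hexagons seen so far). Otherwise only one is allowable: a connection between the two would close
  up to a loop through \<open>v\<close> whose winding numbers around the centres of the hexagons at visited
  vertices are all equal, vanish outside the simply connected domain, and differ between \<open>F\<close> and its
  neighbours. So each newly seen hexagon, including the outside, costs one factor \<open>1 / 2\<close>. From \<open>a\<close>,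
  the first step sees the outside and one hexagon at cost \<open>1 / 2\<close>; from \<open>b\<close>, it sees three hexagons at cost
  \<open>1 / 4\<close>. Either way the total is one factor for each touched hexagon of the domain.
\<close>

text \<open>The geometry is reduced to finite combinatorics by one encoding: a point is represented
  by \<open>hexes_at\<close>, the set of hexagons that contain it, with one element at centres, two
  on open edges and three at vertices. Lattice points are determined by this set, so conditions on
  traces in the plane become conditions on lists.

  The two halves of the dichotomy use different tools. A second allowable move is found by parity:
  the boundary of a finite set of hexagons is a graph with even degrees. Its exclusion needs only
  that winding numbers are locally constant and jump across a single half-edge. When
  \<open>F\<close> is outside, the boundary that is followed is that of the hexagons seen so far, a
  finite set even if \<open>D\<close> is infinite.

  The local count reads \<open>card A * 2 ^ c = 2 ^ c'\<close>, with \<open>c\<close> and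
  \<open>c'\<close> the numbers of classes seen before and after the step. It telescopes, so only
  the classes at the first vertex and at the end matter, and a walk and its reversal visit the same
  vertices. At the start, \<open>2 ^ n\<close> moves meet \<open>n + 1\<close> classes in both
  directions; the surplus factor 2 cancels the outside class.\<close>

section \<open>Point masses of the exploration law under a single move\<close>

lemma successively_take_drop:
  assumes "successively P w"
  shows "successively P (take n w)" "successively P (drop n w)"
  using assms append_take_drop_id[of n w] successively_append_iff[of P "take n w" "drop n w"] by simp_all

text \<open>Each unfolding only appends to the list, and this survives in the limit of the
  approximations. Hence only one branch of a move matters for the mass of a given path.\<close>

lemma explore_extends:
  assumes "w \<in> set_spmf (explore \<delta> R t p)"
  shows "\<exists>xs. w = p @ xs"
proof -
  have "\<forall>p w. w \<in> set_spmf (explore \<delta> R t p) \<longrightarrow> (\<exists>xs. w = p @ xs)"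
  proof (induction rule: explore.fixp_induct)
    case (3 f)
    then show ?case by (fastforce simp: Let_def set_bind_spmf split: if_splits)
  qed simp_all
  then show ?thesis using assms by blast
qed

text \<open>Only the branch that continues along \<open>w\<close> contributes, since the others fix
  a prefix that \<open>w\<close> does not have. The equation is free of division so that it can be
  chained with a count of the allowable mid-edges.\<close>

lemma spmf_explore_step:
  assumes "last p \<noteq> t" "other_endpoint \<delta> (last p) (last (butlast p)) = v"
    "finite (allowable \<delta> R t p v)" "m \<in> allowable \<delta> R t p v" "w = p @ [v, m] @ xs"
  shows "real (card (allowable \<delta> R t p v)) * spmf (explore \<delta> R t p) w = spmf (explore \<delta> R t (p @ [v, m])) w"
proof -
  let ?A = "allowable \<delta> R t p v"
  have zero: "spmf (explore \<delta> R t (p @ [v, n])) w = 0" if "n \<noteq> m" for n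
  proof (rule ccontr)
    assume "spmf (explore \<delta> R t (p @ [v, n])) w \<noteq> 0"
    then have "w \<in> set_spmf (explore \<delta> R t (p @ [v, n]))" by (simp add: in_set_spmf_iff_spmf)
    then obtain ys where "w = (p @ [v, n]) @ ys" using explore_extends by blast
    then show False using that assms(5) by simp
  qed
  have "spmf (explore \<delta> R t p) w = spmf (bind_spmf (spmf_of_set ?A) (\<lambda>m. explore \<delta> R t (p @ [v, m]))) w"
    using assms(1,2) by (subst explore.simps) (simp add: Let_def)
  also have "\<dots> = (\<Sum>n\<in>?A. spmf (explore \<delta> R t (p @ [v, n])) w) / card ?A"
    using assms(3) by (simp add: spmf_bind integral_spmf_of_set)
  also have "(\<Sum>n\<in>?A. spmf (explore \<delta> R t (p @ [v, n])) w) = spmf (explore \<delta> R t (p @ [v, m])) w"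
    using zero assms(3,4) by (subst sum.remove[of _ m]) (auto intro!: sum.neutral)
  finally show ?thesis using assms(3,4) by (auto simp: field_simps)
qed

text \<open>Here \<open>2 ^ n\<close> is the number of first moves and \<open>n + 1\<close> the
  number of classes seen at the first vertex: \<open>n = 1\<close> from \<open>a\<close> and
  \<open>n = 2\<close> from \<open>b\<close>. The single factor 2 on the left stands for the
  outside.\<close>

lemma half_power_eq:
  fixes x y :: real
  assumes "x * 2 * 2 ^ l = 2 ^ Suc n" "y = x / 2 ^ n"
  shows "y = (1 / 2) ^ l"
proof -
  have "x * 2 ^ l = 2 ^ n" using assms(1) by simp
  then have "x = 2 ^ n / 2 ^ l" by (simp add: eq_divide_eq)
  then show ?thesis by (simp add: assms(2) power_one_over)
qed

lemma closed_segment_subset_path_trace: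
  "Suc i < length p \<Longrightarrow> closed_segment (p ! i) (p ! Suc i) \<subseteq> path_trace p"
proof (induction p arbitrary: i rule: path_trace.induct)
  case (3 x y p)
  then show ?case by (cases i) fastforce+
qed auto

text \<open>\<open>f m\<close> is the vertex between \<open>a\<close> and \<open>m\<close>: constant
  when the process leaves the domain boundary, a common endpoint when it starts at an interior
  mid-edge.\<close>

lemma spmf_explore_start:
  assumes "finite S" "m \<in> S" "w = [a, f m, m] @ xs"
  shows "spmf (bind_spmf (spmf_of_set S) (\<lambda>m. explore \<delta> R t [a, f m, m])) w = spmf (explore \<delta> R t [a, f m, m]) w / card S"
proof -
  have zero: "spmf (explore \<delta> R t [a, f n, n]) w = 0" if "n \<noteq> m" for n
  proof (rule ccontr)
    assume "spmf (explore \<delta> R t [a, f n, n]) w \<noteq> 0"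
    then have "w \<in> set_spmf (explore \<delta> R t [a, f n, n])" by (simp add: in_set_spmf_iff_spmf)
    then obtain ys where "w = [a, f n, n] @ ys" using explore_extends by blast
    then show False using that assms(3) by simp
  qed
  have "spmf (bind_spmf (spmf_of_set S) (\<lambda>m. explore \<delta> R t [a, f m, m])) w = (\<Sum>n\<in>S. spmf (explore \<delta> R t [a, f n, n]) w) / card S"
    using assms(1) by (simp add: spmf_bind integral_spmf_of_set)
  also have "(\<Sum>n\<in>S. spmf (explore \<delta> R t [a, f n, n]) w) = spmf (explore \<delta> R t [a, f m, m]) w"
    using zero assms(1,2) by (subst sum.remove[of _ m]) (auto intro!: sum.neutral)
  finally show ?thesis .
qed

section \<open>Geometry of the hexagonal lattice\<close>

locale hex_lattice =
  fixes \<delta> :: real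
  assumes delta_pos: "\<delta> > 0"
begin

section \<open>Coordinates with respect to the lattice of hexagon centres\<close>

text \<open>Real coordinates in which centres are integral, mid-edges are multiples of 1/2 and
  vertices multiples of 1/3, so that incidence questions become integer arithmetic.\<close>

definition hpt :: "real \<Rightarrow> real \<Rightarrow> complex" where
  "hpt x y = of_real (\<delta> * sqrt 3) * (of_real x + of_real y * cis (pi / 3))"

lemma hpt_Re: "Re (hpt x y) = \<delta> * sqrt 3 * (x + y / 2)"
  and hpt_Im: "Im (hpt x y) = \<delta> * (3 / 2) * y"
  by (auto simp: hpt_def cos_60 sin_60 algebra_simps)

lemma hpt_eq_iff [simp]: "hpt x y = hpt x' y' \<longleftrightarrow> x = x' \<and> y = y'"
  using delta_pos by (auto simp: complex_eq_iff hpt_Re hpt_Im)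

lemma hpt_comb: "u *\<^sub>R hpt x y + v *\<^sub>R hpt x' y' = hpt (u * x + v * x') (u * y + v * y')"
  by (simp add: complex_eq_iff hpt_Re hpt_Im algebra_simps add_divide_distrib)

lemma dist_hpt: "(dist (hpt x y) (hpt x' y'))\<^sup>2 =
    3 * \<delta>\<^sup>2 * ((x - x')\<^sup>2 + (x - x') * (y - y') + (y - y')\<^sup>2)"
proof -
  have "(dist (hpt x y) (hpt x' y'))\<^sup>2 =
      (\<delta> * sqrt 3 * (x + y / 2) - \<delta> * sqrt 3 * (x' + y' / 2))\<^sup>2 + (\<delta> * (3 / 2) * y - \<delta> * (3 / 2) * y')\<^sup>2"
    unfolding dist_norm cmod_power2 minus_complex.sel hpt_Re hpt_Im ..
  also have "\<dots> = (sqrt 3)\<^sup>2 * \<delta>\<^sup>2 * ((x - x') + (y - y') / 2)\<^sup>2 + 9 / 4 * \<delta>\<^sup>2 * (y - y')\<^sup>2"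
  proof -
    have "(\<delta> * r * (x + y / 2) - \<delta> * r * (x' + y' / 2))\<^sup>2 = r\<^sup>2 * \<delta>\<^sup>2 * ((x - x') + (y - y') / 2)\<^sup>2" for r
      by (simp add: power2_eq_square field_simps)
    moreover have "(\<delta> * (3 / 2) * y - \<delta> * (3 / 2) * y')\<^sup>2 = 9 / 4 * \<delta>\<^sup>2 * (y - y')\<^sup>2"
      by (simp add: power2_eq_square field_simps)
    ultimately show ?thesis by simp
  qed
  finally show ?thesis by (simp add: power2_eq_square field_simps)
qed

lemma midpoint_hpt: "midpoint (hpt x y) (hpt x' y') = hpt ((x + x') / 2) ((y + y') / 2)"
  using hpt_comb[of "1/2" x y "1/2" x' y'] by (simp add: midpoint_def algebra_simps add_divide_distrib)

lemma hex_center_eq: "hex_center \<delta> (i, j) = hpt i j"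
  by (simp add: hex_center_def hpt_def)

text \<open>The square of \<open>cis (pi / 3)\<close> is \<open>cis (pi / 3) - 1\<close>, so a sixth
  of a turn is an integer matrix in these coordinates.\<close>

lemma cis_sixth_rotate:
  "hpt x y * cis (pi / 3) = hpt (- y) (x + y)"
proof -
  have "cis (pi / 3) * cis (pi / 3) = cis (pi / 3) - 1"
    by (simp add: complex_eq_iff cos_60 sin_60)
  then have "(of_real x + of_real y * cis (pi / 3)) * cis (pi / 3) =
      of_real (- y) + of_real (x + y) * cis (pi / 3)"
    by (simp add: distrib_right mult.assoc) (simp add: algebra_simps)
  then show ?thesis by (simp add: hpt_def mult.assoc)
qed

lemma cis_30: "of_real \<delta> * cis (pi / 6) = hpt (1 / 3) (1 / 3)"
  by (simp add: complex_eq_iff hpt_Re hpt_Im cos_30 sin_30)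

lemma hex_corner_aux:
  "hex_corner \<delta> (i, j) k = hpt i j + hpt (1/3) (1/3) * cis (pi / 3) ^ k"
proof -
  have "cis (pi / 6 + real k * (pi / 3)) = cis (pi / 6) * cis (pi / 3) ^ k"
    by (metis cis_mult Complex.DeMoivre)
  then show ?thesis by (simp add: hex_corner_def hex_center_eq cis_30[symmetric])
qed

lemma hpt_add: "hpt x y + hpt x' y' = hpt (x + x') (y + y')"
  using hpt_comb[of 1 x y 1 x' y'] by simp

text \<open>The corners are the successive rotations of \<open>hpt (1/3) (1/3)\<close>, shifted to
  the centre.\<close>

lemma hex_corner_eqs:
  "hex_corner \<delta> (i, j) 0 = hpt (i + 1/3) (j + 1/3)"
  "hex_corner \<delta> (i, j) (Suc 0) = hpt (i - 1/3) (j + 2/3)"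
  "hex_corner \<delta> (i, j) (Suc (Suc 0)) = hpt (i - 2/3) (j + 1/3)"
  "hex_corner \<delta> (i, j) (Suc (Suc (Suc 0))) = hpt (i - 1/3) (j - 1/3)"
  "hex_corner \<delta> (i, j) (Suc (Suc (Suc (Suc 0)))) = hpt (i + 1/3) (j - 2/3)"
  "hex_corner \<delta> (i, j) (Suc (Suc (Suc (Suc (Suc 0))))) = hpt (i + 2/3) (j - 1/3)"
  by (simp_all add: hex_corner_aux power_Suc2 mult.assoc[symmetric] cis_sixth_rotate hpt_add
        del: power_Suc)

lemma hex_corner_6: "hex_corner \<delta> h (k + 6) = hex_corner \<delta> h k"
proof -
  have "pi / 6 + real (k + 6) * (pi / 3) = (pi / 6 + real k * (pi / 3)) + 2 * pi" by (simp add: field_simps)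
  then have "cis (pi / 6 + real (k + 6) * (pi / 3)) = cis (pi / 6 + real k * (pi / 3))"
    by (simp only: cis_mult[symmetric] cis_2pi mult_1_right)
  then show ?thesis by (simp only: hex_corner_def)
qed

lemma hex_corner_mod: "hex_corner \<delta> h k = hex_corner \<delta> h (k mod 6)"
proof (induction k rule: less_induct)
  case (less k)
  show ?case
  proof (cases "k < 6")
    case False
    then obtain k' where "k = k' + 6" by (metis add.commute le_Suc_ex not_less)
    then show ?thesis using less[of k'] hex_corner_6[of h k'] by simp
  qed simp
qed

section \<open>Vertices and mid-edges in lattice coordinates\<close>

text \<open>The two colours of the bipartite lattice. \<open>upv i j\<close> is the centroid of the
  centres \<open>(i, j)\<close>, \<open>(i + 1, j)\<close>, \<open>(i, j + 1)\<close>, and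
  \<open>dnv i j\<close> that of \<open>(i + 1, j + 1)\<close>, \<open>(i + 1, j)\<close>,
  \<open>(i, j + 1)\<close>.\<close>

definition upv :: "int \<Rightarrow> int \<Rightarrow> complex" where "upv i j = hpt (i + 1/3) (j + 1/3)"
definition dnv :: "int \<Rightarrow> int \<Rightarrow> complex" where "dnv i j = hpt (i + 2/3) (j + 2/3)"

lemma hex_adj_iff: "hex_adj \<delta> u v \<longleftrightarrow>
  (\<exists>i j. {u, v} = {upv i j, dnv i j} \<or> {u, v} = {upv i j, dnv (i - 1) j} \<or> {u, v} = {upv i j, dnv i (j - 1)})"
proof
  assume "hex_adj \<delta> u v"
  then obtain i j k where e: "{u, v} = {hex_corner \<delta> (i, j) k, hex_corner \<delta> (i, j) (Suc k)}"
    unfolding hex_adj_def by auto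
  have s: "hex_corner \<delta> (i, j) (Suc k) = hex_corner \<delta> (i, j) (Suc (k mod 6))"
    by (metis hex_corner_mod mod_Suc_eq)
  have "k mod 6 \<in> {..<6}" by simp
  then consider "k mod 6 = 0" | "k mod 6 = Suc 0" | "k mod 6 = Suc (Suc 0)" | "k mod 6 = Suc (Suc (Suc 0))"
    | "k mod 6 = Suc (Suc (Suc (Suc 0)))" | "k mod 6 = Suc (Suc (Suc (Suc (Suc 0))))" 
    by (auto simp: lessThan_nat_numeral lessThan_Suc)
  then show "\<exists>i j. {u, v} = {upv i j, dnv i j} \<or> {u, v} = {upv i j, dnv (i - 1) j} \<or> {u, v} = {upv i j, dnv i (j - 1)}"
  proof cases
    case 1
    then have "{u, v} = {upv i j, dnv (i - 1) j}"
      using e s hex_corner_mod[of "(i, j)" k] by (simp add: hex_corner_eqs upv_def dnv_def)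
    then show ?thesis by blast
  next
    case 2
    then have "{u, v} = {upv (i - 1) j, dnv (i - 1) j}"
      using e s hex_corner_mod[of "(i, j)" k] by (simp add: hex_corner_eqs upv_def dnv_def insert_commute)
    then show ?thesis by blast
  next
    case 3
    then have "{u, v} = {upv (i - 1) j, dnv (i - 1) (j - 1)}"
      using e s hex_corner_mod[of "(i, j)" k] by (simp add: hex_corner_eqs upv_def dnv_def)
    then show ?thesis by blast
  next
    case 4
    then have "{u, v} = {upv i (j - 1), dnv (i - 1) (j - 1)}"
      using e s hex_corner_mod[of "(i, j)" k] by (simp add: hex_corner_eqs upv_def dnv_def insert_commute)
    then show ?thesis by blast
  next
    case 5
    then have "{u, v} = {upv i (j - 1), dnv i (j - 1)}"
      using e s hex_corner_mod[of "(i, j)" k] by (simp add: hex_corner_eqs upv_def dnv_def)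
    then show ?thesis by blast
  next
    case 6
    moreover have "hex_corner \<delta> (i, j) (Suc (Suc (Suc (Suc (Suc (Suc 0)))))) = hex_corner \<delta> (i, j) 0"
      using hex_corner_6[of "(i, j)" 0] by (simp add: eval_nat_numeral)
    ultimately have "{u, v} = {upv i j, dnv i (j - 1)}"
      using e s hex_corner_mod[of "(i, j)" k] by (simp add: hex_corner_eqs upv_def dnv_def insert_commute)
    then show ?thesis by blast
  qed
next
  assume "\<exists>i j. {u, v} = {upv i j, dnv i j} \<or> {u, v} = {upv i j, dnv (i - 1) j} \<or> {u, v} = {upv i j, dnv i (j - 1)}"
  then obtain i j where "{u, v} = {upv i j, dnv i j} \<or> {u, v} = {upv i j, dnv (i - 1) j} \<or> {u, v} = {upv i j, dnv i (j - 1)}"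
    by blast
  moreover have "{upv i j, dnv i j} = {hex_corner \<delta> (i + 1, j) (Suc 0), hex_corner \<delta> (i + 1, j) (Suc (Suc 0))}"
    by (simp add: hex_corner_eqs upv_def dnv_def insert_commute add.commute)
  moreover have "{upv i j, dnv (i - 1) j} = {hex_corner \<delta> (i, j) 0, hex_corner \<delta> (i, j) (Suc 0)}"
    by (simp add: hex_corner_eqs upv_def dnv_def)
  moreover have "{upv i j, dnv i (j - 1)} = {hex_corner \<delta> (i + 1, j) (Suc (Suc 0)), hex_corner \<delta> (i + 1, j) (Suc (Suc (Suc 0)))}"
    by (simp add: hex_corner_eqs upv_def dnv_def add.commute)
  ultimately show "hex_adj \<delta> u v" unfolding hex_adj_def by metis
qed

text \<open>Every edge has exactly one end of the form \<open>upv i j\<close>, so an edge is indexed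
  by that end and one of three directions \<open>d\<close>.\<close>

definition mdpt :: "nat \<Rightarrow> int \<Rightarrow> int \<Rightarrow> complex" where
  "mdpt d i j = (if d = 0 then hpt (i + 1/2) (j + 1/2) else if d = 1 then hpt i (j + 1/2) else hpt (i + 1/2) j)"

lemma midpoint_upv_dnv:
  "midpoint (upv i j) (dnv i j) = mdpt 0 i j"
  "midpoint (upv i j) (dnv (i - 1) j) = mdpt 1 i j"
  "midpoint (upv i j) (dnv i (j - 1)) = mdpt 2 i j"
  by (simp_all add: upv_def dnv_def mdpt_def midpoint_hpt field_simps)

lemma hpt_int_eqs [simp]: 
  "upv i j = upv k l \<longleftrightarrow> i = k \<and> j = l" "dnv i j = dnv k l \<longleftrightarrow> i = k \<and> j = l"
  by (auto simp: upv_def dnv_def)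

lemma upv_neq_dnv [simp]: "upv i j \<noteq> dnv k l"
proof
  assume "upv i j = dnv k l"
  then have "real_of_int (3 * i + 1) = real_of_int (3 * k + 2)" by (simp add: upv_def dnv_def)
  then show False by (simp only: of_int_eq_iff) presburger
qed

lemma real_int_half_neq: "real_of_int i + 1/2 \<noteq> real_of_int k" 
proof
  assume "real_of_int i + 1/2 = real_of_int k"
  then have "real_of_int (2 * i + 1) = real_of_int (2 * k)" by simp
  then show False by (simp only: of_int_eq_iff) presburger
qed

lemma mdpt_eq_iff: "d < 3 \<Longrightarrow> d' < 3 \<Longrightarrow> mdpt d i j = mdpt d' k l \<longleftrightarrow> d = d' \<and> i = k \<and> j = l"
  using real_int_half_neq[of i k] real_int_half_neq[of j l] real_int_half_neq[of k i] real_int_half_neq[of l j]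
  by (auto simp: mdpt_def)

lemma hex_adj_sym: "hex_adj \<delta> u v \<longleftrightarrow> hex_adj \<delta> v u"
  by (simp add: hex_adj_def insert_commute)

lemma midpoint_cases:
  assumes "hex_adj \<delta> u v"
  obtains i j where
    "{u, v} = {upv i j, dnv i j}" "midpoint u v = mdpt 0 i j"
  | i j where "{u, v} = {upv i j, dnv (i - 1) j}" "midpoint u v = mdpt 1 i j"
  | i j where "{u, v} = {upv i j, dnv i (j - 1)}" "midpoint u v = mdpt 2 i j"
proof -
  from assms obtain i j where "{u, v} = {upv i j, dnv i j} \<or> {u, v} = {upv i j, dnv (i - 1) j} \<or> {u, v} = {upv i j, dnv i (j - 1)}"
    unfolding hex_adj_iff by blast
  moreover have "midpoint u v = midpoint u' v'" if "{u, v} = {u', v'}" for u' v'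
    using that by (auto simp: doubleton_eq_iff midpoint_sym)
  ultimately show thesis using that midpoint_upv_dnv[of i j] by metis
qed

lemma mid_edges_iff: "m \<in> mid_edges \<delta> \<longleftrightarrow> (\<exists>d i j. d < 3 \<and> m = mdpt d i j)"
proof
  assume "m \<in> mid_edges \<delta>"
  then obtain u v where "hex_adj \<delta> u v" "m = midpoint u v" by (auto simp: mid_edges_def)
  then show "\<exists>d i j. d < 3 \<and> m = mdpt d i j"
  proof (elim midpoint_cases)
    fix i j assume "midpoint u v = mdpt 0 i j" then show ?thesis using \<open>m = _\<close> by (intro exI[of _ 0] exI[of _ i] exI[of _ j]) simp
  next
    fix i j assume "midpoint u v = mdpt 1 i j" then show ?thesis using \<open>m = _\<close> by (intro exI[of _ 1] exI[of _ i] exI[of _ j]) simp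
  next
    fix i j assume "midpoint u v = mdpt 2 i j" then show ?thesis using \<open>m = _\<close> by (intro exI[of _ 2] exI[of _ i] exI[of _ j]) simp
  qed
next
  assume "\<exists>d i j. d < 3 \<and> m = mdpt d i j"
  then obtain d i j where *: "d < 3" "m = mdpt d i j" by blast
  then consider "d = 0" | "d = 1" | "d = 2" by linarith
  then show "m \<in> mid_edges \<delta>"
  proof cases
    case 1
    then show ?thesis unfolding mid_edges_def mem_Collect_eq hex_adj_iff *
      by (intro exI[of _ "upv i j"] exI[of _ "dnv i j"]) (auto simp: midpoint_upv_dnv)
  next
    case 2
    then show ?thesis unfolding mid_edges_def mem_Collect_eq hex_adj_iff *
      by (intro exI[of _ "upv i j"] exI[of _ "dnv (i - 1) j"]) (auto simp: midpoint_upv_dnv)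
  next
    case 3
    then show ?thesis unfolding mid_edges_def mem_Collect_eq hex_adj_iff *
      by (intro exI[of _ "upv i j"] exI[of _ "dnv i (j - 1)"]) (auto simp: midpoint_upv_dnv)
  qed
qed

lemma endpoint_mdpt:
  "endpoint \<delta> (mdpt 0 i j) v \<longleftrightarrow> v = upv i j \<or> v = dnv i j"
  "endpoint \<delta> (mdpt 1 i j) v \<longleftrightarrow> v = upv i j \<or> v = dnv (i - 1) j"
  "endpoint \<delta> (mdpt 2 i j) v \<longleftrightarrow> v = upv i j \<or> v = dnv i (j - 1)"
proof -
  have 1: "v = upv i j \<or> v = dnv (i - (if d = 1 then 1 else 0)) (j - (if d = 2 then 1 else 0))"
    if "endpoint \<delta> (mdpt d i j) v" "d < 3" for d
  proof -
    from that(1) obtain w where w: "hex_adj \<delta> v w" "mdpt d i j = midpoint v w" unfolding endpoint_def by blast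
    from w(1) show ?thesis
      by (cases rule: midpoint_cases) (use w(2) that(2) mdpt_eq_iff[of d] in \<open>auto simp: doubleton_eq_iff\<close>)
  qed
  have 2: "endpoint \<delta> (midpoint u v) u" "endpoint \<delta> (midpoint u v) v" if "hex_adj \<delta> u v" for u v
    using that hex_adj_sym midpoint_sym unfolding endpoint_def by metis+
  have 3: "hex_adj \<delta> (upv i j) (dnv i j)" "hex_adj \<delta> (upv i j) (dnv (i - 1) j)" "hex_adj \<delta> (upv i j) (dnv i (j - 1))"
    unfolding hex_adj_iff by blast+
  show "endpoint \<delta> (mdpt 0 i j) v \<longleftrightarrow> v = upv i j \<or> v = dnv i j"
    using 1[of 0] 2[OF 3(1)] by (auto simp: midpoint_upv_dnv)
  show "endpoint \<delta> (mdpt 1 i j) v \<longleftrightarrow> v = upv i j \<or> v = dnv (i - 1) j"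
    using 1[of 1] 2[OF 3(2)] by (auto simp: midpoint_upv_dnv)
  show "endpoint \<delta> (mdpt 2 i j) v \<longleftrightarrow> v = upv i j \<or> v = dnv i (j - 1)"
    using 1[of 2] 2[OF 3(3)] by (auto simp: midpoint_upv_dnv)
qed

section \<open>The hexagons that contain a given point\<close>

definition hexes_at :: "complex \<Rightarrow> (int \<times> int) set" where
  "hexes_at z = {h. z \<in> hexagon \<delta> h}"

text \<open>Three strips that cut out the hexagon. Only the inclusion of the hexagon in the strips
  is derived; membership of points is obtained from the corners by convexity.\<close>

definition hex_slab :: "int \<Rightarrow> int \<Rightarrow> real \<Rightarrow> real \<Rightarrow> bool" where
  "hex_slab p q x y \<longleftrightarrow> \<bar>2 * (x - p) + (y - q)\<bar> \<le> 1 \<and> \<bar>(x - p) + 2 * (y - q)\<bar> \<le> 1 \<and> \<bar>(x - p) - (y - q)\<bar> \<le> 1"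

lemma abs_convex_le: "\<bar>a\<bar> \<le> 1 \<Longrightarrow> \<bar>b\<bar> \<le> 1 \<Longrightarrow> 0 \<le> u \<Longrightarrow> 0 \<le> v \<Longrightarrow> u + v = 1 \<Longrightarrow> \<bar>u * a + v * b\<bar> \<le> (1::real)"
  using convexD[OF convex_real_interval(5)[of "-1" 1], of a b u v] by (simp add: abs_le_iff)

lemma hexagon_slab:
  assumes "hpt x y \<in> hexagon \<delta> (p, q)"
  shows "hex_slab p q x y"
proof -
  let ?S = "{z. \<exists>x y. z = hpt x y \<and> hex_slab p q x y}"
  have "convex ?S"
  proof (rule convexI)
    fix z z' and u v :: real
    assume uv: "0 \<le> u" "0 \<le> v" "u + v = 1" and "z \<in> ?S" "z' \<in> ?S"
    then obtain x y x' y' where z: "z = hpt x y" "z' = hpt x' y'" and s: "hex_slab p q x y" "hex_slab p q x' y'"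
      by blast
    have v: "v = 1 - u" using uv(3) by simp
    have 1: "2 * (u * x + v * x' - p) + (u * y + v * y' - q) = u * (2 * (x - p) + (y - q)) + v * (2 * (x' - p) + (y' - q))"
      unfolding v by (simp add: algebra_simps)
    have 2: "(u * x + v * x' - p) + 2 * (u * y + v * y' - q) = u * ((x - p) + 2 * (y - q)) + v * ((x' - p) + 2 * (y' - q))"
      unfolding v by (simp add: algebra_simps)
    have 3: "(u * x + v * x' - p) - (u * y + v * y' - q) = u * ((x - p) - (y - q)) + v * ((x' - p) - (y' - q))"
      unfolding v by (simp add: algebra_simps)
    have "hex_slab p q (u * x + v * x') (u * y + v * y')"
      using s unfolding hex_slab_def 1 2 3 by (intro conjI abs_convex_le uv) auto
    then show "u *\<^sub>R z + v *\<^sub>R z' \<in> ?S" using z hpt_comb by blast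
  qed
  moreover have "hex_corner \<delta> (p, q) ` {..<6} \<subseteq> ?S"
  proof -
    have "{..<6::nat} = {0, Suc 0, Suc (Suc 0), Suc (Suc (Suc 0)), Suc (Suc (Suc (Suc 0))), Suc (Suc (Suc (Suc (Suc 0))))}"
      by (auto simp: lessThan_nat_numeral lessThan_Suc)
    then show ?thesis by (auto simp: hex_corner_eqs hex_slab_def)
  qed
  ultimately have "hexagon \<delta> (p, q) \<subseteq> ?S" unfolding hexagon_def by (rule hull_minimal[rotated])
  then show ?thesis using assms by auto
qed

lemma convex_hexagon: "convex (hexagon \<delta> h)"
  by (simp add: hexagon_def)

lemma corner_in_hexagon: "hex_corner \<delta> h k \<in> hexagon \<delta> h"
proof -
  have "hex_corner \<delta> h k \<in> hex_corner \<delta> h ` {..<6}" 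
    by (subst hex_corner_mod) simp
  then show ?thesis unfolding hexagon_def by (rule hull_inc)
qed

lemma hexagon_corners:
  "upv i j \<in> hexagon \<delta> (i, j)" "upv i j \<in> hexagon \<delta> (i + 1, j)" "upv i j \<in> hexagon \<delta> (i, j + 1)"
  "dnv i j \<in> hexagon \<delta> (i + 1, j + 1)" "dnv i j \<in> hexagon \<delta> (i + 1, j)" "dnv i j \<in> hexagon \<delta> (i, j + 1)"
  using corner_in_hexagon[of "(i, j)" 0] corner_in_hexagon[of "(i+1, j)" "Suc (Suc 0)"]
    corner_in_hexagon[of "(i, j+1)" "Suc (Suc (Suc (Suc 0)))"]
    corner_in_hexagon[of "(i+1, j+1)" "Suc (Suc (Suc 0))"] corner_in_hexagon[of "(i+1, j)" "Suc 0"]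
    corner_in_hexagon[of "(i, j+1)" "Suc (Suc (Suc (Suc (Suc 0))))"]
  unfolding hex_corner_eqs by (simp_all add: upv_def dnv_def algebra_simps)

lemma hex_center_in: "hex_center \<delta> h \<in> hexagon \<delta> h"
proof (cases h)
  case (Pair i j)
  have "midpoint (hex_corner \<delta> h 0) (hex_corner \<delta> h (Suc (Suc (Suc 0)))) \<in> hexagon \<delta> h"
    by (meson closed_segment_subset convex_hexagon corner_in_hexagon in_mono midpoint_in_closed_segment)
  moreover have "midpoint (hex_corner \<delta> h 0) (hex_corner \<delta> h (Suc (Suc (Suc 0)))) = hex_center \<delta> h"
    unfolding Pair hex_corner_eqs hex_center_eq midpoint_hpt by (simp add: field_simps)
  ultimately show ?thesis by simp
qed

lemma mem_hexes_at: "h \<in> hexes_at z \<longleftrightarrow> z \<in> hexagon \<delta> h"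
  by (simp add: hexes_at_def)

lemma mem_hex_region: "z \<in> hex_region \<delta> D \<longleftrightarrow> hexes_at z \<inter> D \<noteq> {}"
  by (auto simp: hex_region_def hexes_at_def)

lemma hex_slab_shift: "hex_slab p q (real_of_int i + x) (real_of_int j + y) \<longleftrightarrow> hex_slab (p - i) (q - j) x y"
  by (simp add: hex_slab_def algebra_simps)

text \<open>The strips bound integer combinations of \<open>p\<close> and \<open>q\<close>, which
  leaves finitely many cases. The first two items concern vertices, the others open edges; there
  some bounds are strict and exclude the hexagons that contain only an end of the edge.\<close>

lemma hex_slab_cases:
  "hex_slab p q (1/3) (1/3) \<Longrightarrow> (p, q) \<in> {(0, 0), (1, 0), (0, 1)}"
  "hex_slab p q (2/3) (2/3) \<Longrightarrow> (p, q) \<in> {(1, 1), (1, 0), (0, 1)}"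
  "hex_slab p q s s \<Longrightarrow> 1/3 < s \<Longrightarrow> s < 2/3 \<Longrightarrow> (p, q) \<in> {(1, 0), (0, 1)}"
  "hex_slab p q s (1/2 - s/2) \<Longrightarrow> \<bar>s\<bar> < 1/3 \<Longrightarrow> (p, q) \<in> {(0, 0), (0, 1)}"
  "hex_slab p q (1/2 - s/2) s \<Longrightarrow> \<bar>s\<bar> < 1/3 \<Longrightarrow> (p, q) \<in> {(0, 0), (1, 0)}"
proof -
  assume "hex_slab p q (1/3) (1/3)"
  then have "real_of_int (2 * p + q) \<le> 2" "real_of_int (p + 2 * q) \<le> 2" "real_of_int (p - q) \<le> 1"
    "0 \<le> real_of_int (2 * p + q)" "0 \<le> real_of_int (p + 2 * q)" "-1 \<le> real_of_int (p - q)"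
    unfolding hex_slab_def by simp_all linarith+
  then have "2 * p + q \<le> 2" "p + 2 * q \<le> 2" "p - q \<le> 1" "0 \<le> 2 * p + q" "0 \<le> p + 2 * q" "-1 \<le> p - q"
    by linarith+
  then show "(p, q) \<in> {(0, 0), (1, 0), (0, 1)}" by simp presburger
next
  assume "hex_slab p q (2/3) (2/3)"
  then have "real_of_int (2 * p + q) \<le> 3" "real_of_int (p + 2 * q) \<le> 3" "real_of_int (p - q) \<le> 1"
    "1 \<le> real_of_int (2 * p + q)" "1 \<le> real_of_int (p + 2 * q)" "-1 \<le> real_of_int (p - q)"
    unfolding hex_slab_def by simp_all linarith+
  then have "2 * p + q \<le> 3" "p + 2 * q \<le> 3" "p - q \<le> 1" "1 \<le> 2 * p + q" "1 \<le> p + 2 * q" "-1 \<le> p - q"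
    by linarith+
  then show "(p, q) \<in> {(1, 1), (1, 0), (0, 1)}" by simp presburger
next
  assume "hex_slab p q s s" "1/3 < s" "s < 2/3"
  then have "real_of_int (2 * p + q) < 3" "real_of_int (p + 2 * q) < 3" "real_of_int (p - q) \<le> 1"
    "0 < real_of_int (2 * p + q)" "0 < real_of_int (p + 2 * q)" "-1 \<le> real_of_int (p - q)"
    unfolding hex_slab_def by simp_all linarith+
  then have "2 * p + q < 3" "p + 2 * q < 3" "p - q \<le> 1" "0 < 2 * p + q" "0 < p + 2 * q" "-1 \<le> p - q"
    by linarith+
  then show "(p, q) \<in> {(1, 0), (0, 1)}" by simp presburger
next
  assume "hex_slab p q s (1/2 - s/2)" "\<bar>s\<bar> < 1/3"
  then have "real_of_int (2 * p + q) < 2" "real_of_int (p + 2 * q) \<le> 2" "real_of_int (p - q) < 1"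
    "-1 < real_of_int (2 * p + q)" "0 \<le> real_of_int (p + 2 * q)" "-2 < real_of_int (p - q)"
    unfolding hex_slab_def by simp_all linarith+
  then have "2 * p + q < 2" "p + 2 * q \<le> 2" "p - q < 1" "-1 < 2 * p + q" "0 \<le> p + 2 * q" "-2 < p - q"
    by linarith+
  then show "(p, q) \<in> {(0, 0), (0, 1)}" by simp presburger
next
  assume "hex_slab p q (1/2 - s/2) s" "\<bar>s\<bar> < 1/3"
  then have "real_of_int (2 * p + q) \<le> 2" "real_of_int (p + 2 * q) < 2" "real_of_int (p - q) < 2"
    "0 \<le> real_of_int (2 * p + q)" "-1 < real_of_int (p + 2 * q)" "-1 < real_of_int (p - q)"
    unfolding hex_slab_def by simp_all linarith+
  then have "2 * p + q \<le> 2" "p + 2 * q < 2" "p - q < 2" "0 \<le> 2 * p + q" "-1 < p + 2 * q" "-1 < p - q"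
    by linarith+
  then show "(p, q) \<in> {(0, 0), (1, 0)}" by simp presburger
qed

lemma hexes_at_upv: "hexes_at (upv i j) = {(i, j), (i + 1, j), (i, j + 1)}"
proof -
  have "(p, q) \<in> {(i, j), (i + 1, j), (i, j + 1)}" if "(p, q) \<in> hexes_at (upv i j)" for p q
    using that hexagon_slab hex_slab_shift hex_slab_cases(1)[of "p - i" "q - j"]
    unfolding mem_hexes_at upv_def by fastforce
  then have "hexes_at (upv i j) \<subseteq> {(i, j), (i + 1, j), (i, j + 1)}" by (metis subsetI surj_pair)
  moreover have "{(i, j), (i + 1, j), (i, j + 1)} \<subseteq> hexes_at (upv i j)" using hexagon_corners[of i j] by (simp add: mem_hexes_at)
  ultimately show ?thesis by (rule equalityI)
qed

lemma hexes_at_dnv: "hexes_at (dnv i j) = {(i + 1, j + 1), (i + 1, j), (i, j + 1)}"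
proof -
  have "(p, q) \<in> {(i + 1, j + 1), (i + 1, j), (i, j + 1)}" if "(p, q) \<in> hexes_at (dnv i j)" for p q
    using that hexagon_slab hex_slab_shift hex_slab_cases(2)[of "p - i" "q - j"]
    unfolding mem_hexes_at dnv_def by fastforce
  then have "hexes_at (dnv i j) \<subseteq> {(i + 1, j + 1), (i + 1, j), (i, j + 1)}" by (metis subsetI surj_pair)
  moreover have "{(i + 1, j + 1), (i + 1, j), (i, j + 1)} \<subseteq> hexes_at (dnv i j)" using hexagon_corners[of i j] by (simp add: mem_hexes_at)
  ultimately show ?thesis by (rule equalityI)
qed

lemma hexes_at_segment:
  assumes "z \<in> closed_segment x y"
  shows "hexes_at x \<inter> hexes_at y \<subseteq> hexes_at z"
  using assms convex_hexagon closed_segment_subset unfolding mem_hexes_at subset_iff Int_iff by blast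

text \<open>The edge with centre \<open>mdpt d i j\<close> is parametrised by \<open>\<bar>s\<bar> \<le> 1 / 6\<close>; the terms \<open>2 * s / 2\<close> are left
  unsimplified to match \<open>hex_slab_cases\<close>.\<close>

definition edge_pt :: "nat \<Rightarrow> int \<Rightarrow> int \<Rightarrow> real \<Rightarrow> complex" where
  "edge_pt d i j s = (if d = 0 then hpt (i + (1/2 - s)) (j + (1/2 - s))
     else if d = 1 then hpt (i + 2 * s) (j + (1/2 - (2 * s) / 2)) else hpt (i + (1/2 - (2 * s) / 2)) (j + 2 * s))"

definition dnv_at :: "nat \<Rightarrow> int \<Rightarrow> int \<Rightarrow> complex" where
  "dnv_at d i j = (if d = 0 then dnv i j else if d = 1 then dnv (i - 1) j else dnv i (j - 1))"

definition hexes_mdpt :: "nat \<Rightarrow> int \<Rightarrow> int \<Rightarrow> (int \<times> int) set" where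
  "hexes_mdpt d i j = (if d = 0 then {(i + 1, j), (i, j + 1)} else if d = 1 then {(i, j), (i, j + 1)} else {(i, j), (i + 1, j)})"

lemma endpoint_mdpt_iff: "d < 3 \<Longrightarrow> endpoint \<delta> (mdpt d i j) v \<longleftrightarrow> v = upv i j \<or> v = dnv_at d i j"
proof -
  assume "d < 3"
  then consider "d = 0" | "d = 1" | "d = 2" by linarith
  then show ?thesis by cases (simp_all add: endpoint_mdpt dnv_at_def flip: One_nat_def)
qed

lemma edge_pt_simps: 
  "edge_pt d i j 0 = mdpt d i j" 
  "edge_pt d i j (1/6) = upv i j" if "d < 3"
  using that by (auto simp: edge_pt_def mdpt_def upv_def dnv_at_def dnv_def)

lemma edge_pt_dnv_at: "edge_pt d i j (-1/6) = dnv_at d i j" if "d < 3"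
  using that by (auto simp: edge_pt_def mdpt_def upv_def dnv_at_def dnv_def)

lemma edge_pt_comb: "u + v = 1 \<Longrightarrow> u *\<^sub>R edge_pt d i j s + v *\<^sub>R edge_pt d i j t = edge_pt d i j (u * s + v * t)"
proof -
  assume "u + v = 1"
  then have "v = 1 - u" by simp
  then show ?thesis by (simp add: edge_pt_def hpt_comb) (simp add: algebra_simps add_divide_distrib diff_divide_distrib)
qed

lemma hexes_at_ends: "hexes_at (upv i j) \<inter> hexes_at (dnv_at d i j) = hexes_mdpt d i j"
  by (auto simp: hexes_at_upv hexes_at_dnv dnv_at_def hexes_mdpt_def)

lemma hexes_at_edge_pt:
  assumes "d < 3" "\<bar>s\<bar> < 1/6"
  shows "hexes_at (edge_pt d i j s) = hexes_mdpt d i j"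
proof
  show "hexes_at (edge_pt d i j s) \<subseteq> hexes_mdpt d i j"
  proof
    fix h assume h: "h \<in> hexes_at (edge_pt d i j s)"
    obtain p q where pq: "h = (p, q)" by (cases h)
    have 0: "hex_slab (p - i) (q - j) (1/2 - s) (1/2 - s)" if "d = 0"
      using h that unfolding pq mem_hexes_at edge_pt_def by (metis hexagon_slab hex_slab_shift)
    have 1: "hex_slab (p - i) (q - j) (2 * s) (1/2 - (2 * s) / 2)" if "d = 1"
      using h that unfolding pq mem_hexes_at edge_pt_def by (metis hexagon_slab hex_slab_shift zero_neq_one)
    have 2: "hex_slab (p - i) (q - j) (1/2 - (2 * s) / 2) (2 * s)" if "d = 2"
      using h that unfolding pq mem_hexes_at edge_pt_def by (metis hexagon_slab hex_slab_shift zero_neq_numeral one_eq_numeral_iff semiring_norm(85))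
    consider "d = 0" | "d = 1" | "d = 2" using assms(1) by linarith
    then show "h \<in> hexes_mdpt d i j"
    proof cases
      case c: 1
      have "(p - i, q - j) \<in> {(1, 0), (0, 1)}" by (rule hex_slab_cases(3)[OF 0[OF c]]) (use assms(2) in auto)
      then show ?thesis using c by (auto simp: pq hexes_mdpt_def)
    next
      case c: 2
      have "(p - i, q - j) \<in> {(0, 0), (0, 1)}" by (rule hex_slab_cases(4)[OF 1[OF c]]) (use assms(2) in auto)
      then show ?thesis using c by (auto simp: pq hexes_mdpt_def)
    next
      case c: 3
      have "(p - i, q - j) \<in> {(0, 0), (1, 0)}" by (rule hex_slab_cases(5)[OF 2[OF c]]) (use assms(2) in auto)
      then show ?thesis using c by (auto simp: pq hexes_mdpt_def)
    qed
  qed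
  have "edge_pt d i j s \<in> closed_segment (upv i j) (dnv_at d i j)"
    unfolding closed_segment_def mem_Collect_eq edge_pt_simps(2)[OF assms(1), symmetric] edge_pt_dnv_at[OF assms(1), symmetric]
  \<comment> \<open>The edge runs from parameter 1/6 to -1/6, so \<open>s\<close> is reached at the
    fraction \<open>(1/6 - s) / (1/3)\<close>.\<close>
  proof (intro exI[of _ "1/2 - 3 * s"] conjI)
    have "(1 - (1/2 - 3 * s)) * (1/6) + (1/2 - 3 * s) * (-1/6) = s" by (simp add: field_simps)
    then show "edge_pt d i j s = (1 - (1/2 - 3 * s)) *\<^sub>R edge_pt d i j (1/6) + (1/2 - 3 * s) *\<^sub>R edge_pt d i j (-1/6)"
      by (simp only: edge_pt_comb diff_add_cancel)
  qed (use assms(2) in auto)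
  then show "hexes_mdpt d i j \<subseteq> hexes_at (edge_pt d i j s)"
    using hexes_at_segment hexes_at_ends by metis
qed

section \<open>Vertices and mid-edges identified by their hexagons\<close>

definition is_vertex :: "complex \<Rightarrow> bool" where
  "is_vertex v \<longleftrightarrow> (\<exists>m. endpoint \<delta> m v)"

lemma endpoint_cases:
  assumes "endpoint \<delta> m v"
  obtains d i j where "d < 3" "m = mdpt d i j" "v = upv i j \<or> v = dnv_at d i j"
proof -
  have "m \<in> mid_edges \<delta>" using assms unfolding endpoint_def mid_edges_def by blast
  then show thesis using assms that endpoint_mdpt_iff unfolding mid_edges_iff by blast
qed

lemma endpoint_mid_edge: "endpoint \<delta> m v \<Longrightarrow> m \<in> mid_edges \<delta>"
  unfolding endpoint_def mid_edges_def by blast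

lemma is_vertex_iff: "is_vertex v \<longleftrightarrow> (\<exists>i j. v = upv i j \<or> v = dnv i j)"
proof
  assume "is_vertex v"
  then show "\<exists>i j. v = upv i j \<or> v = dnv i j"
    unfolding is_vertex_def dnv_at_def by (metis endpoint_cases dnv_at_def)
next
  assume "\<exists>i j. v = upv i j \<or> v = dnv i j"
  then show "is_vertex v" unfolding is_vertex_def using endpoint_mdpt(1) by blast
qed

lemma endpoint_hexes:
  assumes "endpoint \<delta> m v" shows "hexes_at m \<subseteq> hexes_at v"
  using assms
proof (cases rule: endpoint_cases)
  case (1 d i j)
  then show ?thesis using hexes_at_edge_pt[of d 0 i j] hexes_at_ends[of i j d] by (auto simp: edge_pt_simps)
qed

lemma hexes_at_half_edge:
  assumes "endpoint \<delta> m v" "z \<in> closed_segment m v" "z \<noteq> v"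
  shows "hexes_at z = hexes_at m"
  using assms(1)
proof (cases rule: endpoint_cases)
  case (1 d i j)
  define c :: real where "c = (if v = upv i j then 1/6 else -1/6)"
  have v: "v = edge_pt d i j c" using 1(3) by (auto simp: c_def edge_pt_simps edge_pt_dnv_at[OF 1(1), simplified] 1(1))
  obtain t where t: "0 \<le> t" "t \<le> 1" "z = (1 - t) *\<^sub>R m + t *\<^sub>R v" using assms(2) by (auto simp: closed_segment_def)
  then have z: "z = edge_pt d i j (t * c)"
    unfolding v 1(2) edge_pt_simps(1)[OF 1(1), symmetric] by (simp add: edge_pt_comb)
  have "t \<noteq> 1" using assms(3) z v by auto
  then have "\<bar>t * c\<bar> < 1/6" using t by (auto simp: c_def)
  then show ?thesis using z 1 hexes_at_edge_pt[of d _ i j] edge_pt_simps(1)[OF 1(1), of i j] by (metis abs_zero zero_less_divide_1_iff zero_less_numeral)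
qed

lemma card_hexes_vertex: "is_vertex v \<Longrightarrow> card (hexes_at v) = 3"
  by (auto simp: is_vertex_iff hexes_at_upv hexes_at_dnv card_insert_if)

lemma hexes_at_mdpt: "d < 3 \<Longrightarrow> hexes_at (mdpt d i j) = hexes_mdpt d i j"
  using hexes_at_edge_pt[of d 0 i j] by (simp add: edge_pt_simps)

lemma card_hexes_mid_edge: "m \<in> mid_edges \<delta> \<Longrightarrow> card (hexes_at m) = 2"
  by (auto simp: mid_edges_iff hexes_at_mdpt hexes_mdpt_def card_insert_if)

text \<open>Summing the coordinates of the three hexagons gives three times the coordinates of the
  vertex: \<open>3 * i + 1\<close> and \<open>3 * j + 1\<close> at \<open>upv i j\<close>,
  \<open>3 * i + 2\<close> and \<open>3 * j + 2\<close> at \<open>dnv i j\<close>. The residue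
  modulo 3 tells the colours apart.\<close>

lemma hexes_at_vertex_inj:
  assumes "is_vertex v" "is_vertex w" "hexes_at v = hexes_at w"
  shows "v = w"
proof -
  have u: "sum f (hexes_at (upv i j)) = f (i, j) + f (i + 1, j) + f (i, j + 1)"
    and d: "sum f (hexes_at (dnv i j)) = f (i + 1, j + 1) + f (i + 1, j) + f (i, j + 1)"
    for f :: "int \<times> int \<Rightarrow> int" and i j
    by (simp_all add: hexes_at_upv hexes_at_dnv)
  have "sum fst (hexes_at v) = sum fst (hexes_at w)" "sum snd (hexes_at v) = sum snd (hexes_at w)"
    using assms(3) by simp_all
  moreover obtain i j k l where "v = upv i j \<or> v = dnv i j" "w = upv k l \<or> w = dnv k l"
    using assms(1,2) unfolding is_vertex_iff by blast
  moreover have "3 * i + 1 \<noteq> 3 * k + 2" "3 * k + 1 \<noteq> 3 * i + 2" by presburger+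
  ultimately show ?thesis by (auto simp: u d)
qed

lemma hexes_at_mid_edge_inj: "m \<in> mid_edges \<delta> \<Longrightarrow> n \<in> mid_edges \<delta> \<Longrightarrow> hexes_at m = hexes_at n \<Longrightarrow> m = n"
proof -
  assume "m \<in> mid_edges \<delta>" "n \<in> mid_edges \<delta>" and e: "hexes_at m = hexes_at n"
  then obtain d i j d' i' j' where *: "d < 3" "m = mdpt d i j" "d' < 3" "n = mdpt d' i' j'" unfolding mid_edges_iff by blast
  have "hexes_mdpt d i j = hexes_mdpt d' i' j'" using e * by (simp add: hexes_at_mdpt)
  then have "(d = 0 \<or> d = 1 \<or> d = 2) \<and> (d' = 0 \<or> d' = 1 \<or> d' = 2) \<and> d = d' \<and> i = i' \<and> j = j'"
    using *(1,3) unfolding hexes_mdpt_def by (auto simp: doubleton_eq_iff split: if_splits)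
  then show "m = n" using * by simp
qed

lemma mid_edge_exists:
  assumes "is_vertex v" "h \<in> hexes_at v" 
  shows "\<exists>m. endpoint \<delta> m v \<and> hexes_at m = hexes_at v - {h}"
proof -
  from assms(1) consider i j where "v = upv i j" | i j where "v = dnv i j" unfolding is_vertex_iff by blast
  then show ?thesis
  proof cases
    case 1
    then consider "h = (i, j)" | "h = (i + 1, j)" | "h = (i, j + 1)" using assms(2) hexes_at_upv by auto
    then show ?thesis
    proof cases
      case a: 1
      show ?thesis unfolding 1 a by (intro exI[of _ "mdpt 0 i j"]) (auto simp: endpoint_mdpt hexes_at_mdpt hexes_at_upv hexes_mdpt_def)
    next
      case a: 2
      show ?thesis unfolding 1 a by (intro exI[of _ "mdpt 1 i j"]) (auto simp: endpoint_mdpt hexes_at_mdpt hexes_at_upv hexes_mdpt_def simp del: One_nat_def)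
    next
      case a: 3
      show ?thesis unfolding 1 a by (intro exI[of _ "mdpt 2 i j"]) (auto simp: endpoint_mdpt hexes_at_mdpt hexes_at_upv hexes_mdpt_def)
    qed
  next
    case 2
    then consider "h = (i + 1, j + 1)" | "h = (i + 1, j)" | "h = (i, j + 1)" using assms(2) hexes_at_dnv by auto
    then show ?thesis
    proof cases
      case a: 1
      show ?thesis unfolding 2 a by (intro exI[of _ "mdpt 0 i j"]) (auto simp: endpoint_mdpt hexes_at_mdpt hexes_at_dnv hexes_mdpt_def)
    next
      case a: 2
      show ?thesis unfolding 2 a by (intro exI[of _ "mdpt 2 i (j + 1)"]) (auto simp: endpoint_mdpt hexes_at_mdpt hexes_at_dnv hexes_mdpt_def)
    next
      case a: 3
      show ?thesis unfolding 2 a by (intro exI[of _ "mdpt 1 (i + 1) j"]) (auto simp: endpoint_mdpt hexes_at_mdpt hexes_at_dnv hexes_mdpt_def simp del: One_nat_def)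
    qed
  qed
qed

text \<open>The two-colouring of the vertices on which the handshake argument rests.\<close>

definition up_vertex :: "complex \<Rightarrow> bool" where "up_vertex v \<longleftrightarrow> (\<exists>i j. v = upv i j)"

lemma mid_edge_endpoints:
  assumes "m \<in> mid_edges \<delta>"
  obtains u v where "up_vertex u" "\<not> up_vertex v" "hexes_at u \<inter> hexes_at v = hexes_at m"
    "m = midpoint u v" "{x. endpoint \<delta> m x} = {u, v}"
proof -
  obtain d i j where *: "d < 3" "m = mdpt d i j" using assms unfolding mid_edges_iff by blast
  show thesis
  proof (rule that[of "upv i j" "dnv_at d i j"])
    show "up_vertex (upv i j)" by (auto simp: up_vertex_def)
    show "\<not> up_vertex (dnv_at d i j)" using upv_neq_dnv by (metis up_vertex_def dnv_at_def)
    show "hexes_at (upv i j) \<inter> hexes_at (dnv_at d i j) = hexes_at m" using * by (simp add: hexes_at_ends hexes_at_mdpt)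
    show "m = midpoint (upv i j) (dnv_at d i j)"
      using * midpoint_upv_dnv[of i j] by (cases "d = 0"; cases "d = 1") (auto simp: dnv_at_def less_Suc_eq numeral_3_eq_3 numeral_2_eq_2)
  qed (use * endpoint_mdpt_iff in auto)
qed

lemma two_endpoints:
  assumes "endpoint \<delta> m u" "endpoint \<delta> m v" "u \<noteq> v"
  shows "m = midpoint u v" "{x. endpoint \<delta> m x} = {u, v}"
proof -
  obtain p q where pq: "up_vertex p" "\<not> up_vertex q" "hexes_at p \<inter> hexes_at q = hexes_at m"
    "m = midpoint p q" "{x. endpoint \<delta> m x} = {p, q}"
    using mid_edge_endpoints[OF endpoint_mid_edge[OF assms(1)]] by blast
  have "u \<in> {p, q}" "v \<in> {p, q}" using assms(1,2) unfolding pq(5)[symmetric] by auto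
  then have "u = p \<and> v = q \<or> u = q \<and> v = p" using assms(3) by auto
  then show "m = midpoint u v" "{x. endpoint \<delta> m x} = {u, v}" using pq(4,5) by (auto simp: midpoint_sym)
qed

text \<open>Scaling towards the centre by \<open>t < 1\<close> makes the three strip inequalities
  strict. A second hexagon at \<open>w\<close> would be displaced by \<open>(P, Q)\<close> with
  \<open>2 * P + Q\<close>, \<open>P + 2 * Q\<close> and \<open>P - Q\<close> all below 2 in
  absolute value, which leaves only zero.\<close>

lemma hexes_at_center_segment:
  assumes "z \<in> hexagon \<delta> h" "w \<in> closed_segment (hex_center \<delta> h) z" "w \<noteq> z"
  shows "hexes_at w = {h}"
proof -
  obtain p q where h: "h = (p, q)" by (cases h)
  obtain x y :: real where z: "z = hpt (p + x) (q + y)"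
  proof -
    have "z = hpt (Re z / (\<delta> * sqrt 3) - Im z / (\<delta> * (3 / 2)) / 2) (Im z / (\<delta> * (3 / 2)))"
      using delta_pos by (simp add: complex_eq_iff hpt_Re hpt_Im)
    then show thesis using that[of "(Re z / (\<delta> * sqrt 3) - Im z / (\<delta> * (3 / 2)) / 2) - real_of_int p" "Im z / (\<delta> * (3 / 2)) - real_of_int q"] by simp
  qed
  have s: "\<bar>2 * x + y\<bar> \<le> 1" "\<bar>x + 2 * y\<bar> \<le> 1" "\<bar>x - y\<bar> \<le> 1"
    using hexagon_slab[of "p + x" "q + y" p q] assms(1) unfolding z h hex_slab_def by auto
  obtain t where t: "0 \<le> t" "t \<le> 1" "w = (1 - t) *\<^sub>R hex_center \<delta> h + t *\<^sub>R z"
    using assms(2) by (auto simp: closed_segment_def)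
  have t1: "t < 1" using t assms(3) by (cases "t = 1") auto
  have w: "w = hpt (p + t * x) (q + t * y)" 
    unfolding t(3) z h hex_center_eq hpt_comb by (simp add: algebra_simps)
  have lt: "\<bar>t * a\<bar> < 1" if "\<bar>a\<bar> \<le> 1" for a
  proof -
    have "\<bar>t * a\<bar> \<le> t * 1" unfolding abs_mult using that t(1) by (intro mult_mono) auto
    then show ?thesis using t1 by simp
  qed
  have "h' = h" if "h' \<in> hexes_at w" for h'
  proof -
    obtain p' q' where h': "h' = (p', q')" by (cases h')
    define P Q where "P = p' - p" and "Q = q' - q"
    have "hex_slab P Q (t * x) (t * y)"
      using that hexagon_slab hex_slab_shift unfolding mem_hexes_at w h' P_def Q_def by blast
    moreover have "\<bar>2 * (t * x) + t * y\<bar> < 1" "\<bar>t * x + 2 * (t * y)\<bar> < 1" "\<bar>t * x - t * y\<bar> < 1"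
      using lt[OF s(1)] lt[OF s(2)] lt[OF s(3)] by (simp_all add: algebra_simps)
    ultimately have "\<bar>real_of_int (2 * P + Q)\<bar> < 2" "\<bar>real_of_int (P + 2 * Q)\<bar> < 2" "\<bar>real_of_int (P - Q)\<bar> < 2"
      unfolding hex_slab_def by (simp_all add: abs_le_iff abs_less_iff)
    then have "-2 < 2 * P + Q" "2 * P + Q < 2" "-2 < P + 2 * Q" "P + 2 * Q < 2" "-2 < P - Q" "P - Q < 2" by linarith+
    then have "P = 0 \<and> Q = 0" by presburger
    then show ?thesis by (simp add: h h' P_def Q_def)
  qed
  moreover have "h \<in> hexes_at w"
    unfolding mem_hexes_at using assms(2) closed_segment_subset[OF hex_center_in assms(1) convex_hexagon] by blast
  ultimately show ?thesis by blast
qed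

lemma hexes_at_center: "hexes_at (hex_center \<delta> h) = {h}"
proof -
  \<comment> \<open>The segment lemma leaves out the far end, so the centre is joined to a vertex of
    \<open>h\<close>. The two differ because three times the coordinates of a vertex are not
    divisible by 3.\<close>
  have "\<exists>v. is_vertex v \<and> v \<in> hexagon \<delta> h"
    using hexagon_corners(1) unfolding is_vertex_iff by (metis surj_pair)
  then obtain v where v: "is_vertex v" "v \<in> hexagon \<delta> h" by blast
  have "hex_center \<delta> h \<noteq> v" 
  proof
    assume "hex_center \<delta> h = v"
    moreover obtain p q where "h = (p, q)" by (cases h)
    moreover obtain i j where "v = upv i j \<or> v = dnv i j" using v(1) is_vertex_iff by blast
    ultimately have "real_of_int (3 * p) = real_of_int (3 * i + 1) \<or> real_of_int (3 * p) = real_of_int (3 * i + 2)"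
      by (auto simp: hex_center_eq upv_def dnv_def)
    then show False unfolding of_int_eq_iff by presburger
  qed
  then show ?thesis using hexes_at_center_segment[OF v(2)] by auto
qed

lemma finite_vertices_hexagon: "finite {v. is_vertex v \<and> h \<in> hexes_at v}"
proof -
  obtain p q where h: "h = (p, q)" by (cases h)
  have "{v. is_vertex v \<and> h \<in> hexes_at v} \<subseteq> (\<lambda>(i, j). upv i j) ` ({p - 1..p} \<times> {q - 1..q}) \<union> (\<lambda>(i, j). dnv i j) ` ({p - 1..p} \<times> {q - 1..q})"
  proof
    fix v assume "v \<in> {v. is_vertex v \<and> h \<in> hexes_at v}"
    then have "\<exists>i j. (v = upv i j \<or> v = dnv i j) \<and> (i, j) \<in> {p - 1..p} \<times> {q - 1..q}"
      unfolding is_vertex_iff h mem_Collect_eq by (elim conjE exE disjE) (force simp: hexes_at_upv hexes_at_dnv)+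
    then show "v \<in> (\<lambda>(i, j). upv i j) ` ({p - 1..p} \<times> {q - 1..q}) \<union> (\<lambda>(i, j). dnv i j) ` ({p - 1..p} \<times> {q - 1..q})"
      by force
  qed
  then show ?thesis by (rule finite_subset) auto
qed

section \<open>Distances between mid-edges\<close>

lemma dist_endpoint: "endpoint \<delta> m v \<Longrightarrow> dist m v \<le> \<delta> / 2"
proof (cases rule: endpoint_cases, assumption)
  fix d i j assume *: "d < 3" "m = mdpt d i j" "v = upv i j \<or> v = dnv_at d i j"
  then have "(dist m v)\<^sup>2 = \<delta>\<^sup>2 / 4"
    by (auto simp: mdpt_def upv_def dnv_at_def dnv_def dist_hpt power_divide less_Suc_eq numeral_3_eq_3)
  then have "(dist m v)\<^sup>2 \<le> (\<delta> / 2)\<^sup>2" by (simp add: power_divide)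
  then show "dist m v \<le> \<delta> / 2" by (rule power2_le_imp_le) (use delta_pos in simp)
qed

lemma dist_mid_edges_iff:
  assumes "m \<in> mid_edges \<delta>" "n \<in> mid_edges \<delta>" "m \<noteq> n"
  shows "dist m n \<le> \<delta> \<longleftrightarrow> (\<exists>v. endpoint \<delta> m v \<and> endpoint \<delta> n v)"
proof
  assume "\<exists>v. endpoint \<delta> m v \<and> endpoint \<delta> n v"
  then obtain v where "dist m v \<le> \<delta> / 2" "dist n v \<le> \<delta> / 2" using dist_endpoint by blast
  then show "dist m n \<le> \<delta>" using dist_triangle2[of m n v] by linarith
next
  assume le: "dist m n \<le> \<delta>"
  obtain d i j d' i' j' where *: "d < 3" "m = mdpt d i j" "d' < 3" "n = mdpt d' i' j'" using assms unfolding mid_edges_iff by blast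
  \<comment> \<open>Doubled coordinate differences are integers. The squared distance is
    \<open>3/4 * \<delta>^2\<close> times the form \<open>X^2 + X * Y + Y^2\<close>, so this form is
    at most 1.\<close>
  define X where "X = 2 * (i - i') + (if d = 1 then 0 else 1) - (if d' = 1 then 0 else 1)"
  define Y where "Y = 2 * (j - j') + (if d = 2 then 0 else 1) - (if d' = 2 then 0 else 1)"
  have "(dist m n)\<^sup>2 = 3 * \<delta>\<^sup>2 * ((X / 2)\<^sup>2 + (X / 2) * (Y / 2) + (Y / 2)\<^sup>2)"
  proof -
    have "m = hpt (i + (if d = 1 then 0 else 1/2)) (j + (if d = 2 then 0 else 1/2))"
      "n = hpt (i' + (if d' = 1 then 0 else 1/2)) (j' + (if d' = 2 then 0 else 1/2))"
      using * by (auto simp: mdpt_def less_Suc_eq numeral_3_eq_3 numeral_2_eq_2)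
    moreover have "(i + (if d = 1 then 0 else 1/2)) - (i' + (if d' = 1 then 0 else 1/2)) = X / 2"
      "(j + (if d = 2 then 0 else 1/2)) - (j' + (if d' = 2 then 0 else 1/2)) = Y / 2"
      by (auto simp: X_def Y_def field_simps)
    ultimately show ?thesis by (simp only: dist_hpt)
  qed
  moreover have "(dist m n)\<^sup>2 \<le> \<delta>\<^sup>2" using le by (simp add: power_mono)
  ultimately have "\<delta>\<^sup>2 * (3 * ((X / 2)\<^sup>2 + (X / 2) * (Y / 2) + (Y / 2)\<^sup>2)) \<le> \<delta>\<^sup>2 * 1"
    by (simp only: mult_1_right mult.left_commute)
  then have "3 * ((X / 2)\<^sup>2 + (X / 2) * (Y / 2) + (Y / 2)\<^sup>2) \<le> 1"
    using delta_pos by (subst (asm) mult_le_cancel_left_pos) auto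
  then have "real_of_int (3 * (X * X + X * Y + Y * Y)) \<le> real_of_int 4" by (simp add: power2_eq_square field_simps)
  then have q: "3 * (X * X + X * Y + Y * Y) \<le> 4" by (simp only: of_int_le_iff)
  \<comment> \<open>Four times the form is \<open>(X + 2 * Y)^2 + 3 * X^2\<close>, so
    \<open>|X| >= 2\<close> would make the form at least 3.\<close>
  have "\<bar>X\<bar> \<le> 1"
  proof (rule ccontr)
    assume "\<not> \<bar>X\<bar> \<le> 1"
    then have "2 * 2 \<le> X * X" using abs_le_square_iff[of 2 X] by (simp add: power2_eq_square)
    moreover have "0 \<le> (X + 2 * Y) * (X + 2 * Y)" by simp
    ultimately show False using q by (simp add: algebra_simps)
  qed
  moreover have "\<bar>Y\<bar> \<le> 1"
  proof (rule ccontr)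
    assume "\<not> \<bar>Y\<bar> \<le> 1"
    then have "2 * 2 \<le> Y * Y" using abs_le_square_iff[of 2 Y] by (simp add: power2_eq_square)
    moreover have "0 \<le> (Y + 2 * X) * (Y + 2 * X)" by simp
    ultimately show False using q by (simp add: algebra_simps)
  qed
  ultimately have X: "-1 \<le> X" "X \<le> 1" and Y: "-1 \<le> Y" "Y \<le> 1" by auto
  have XY: "\<not> (X = 1 \<and> Y = 1)" "\<not> (X = -1 \<and> Y = -1)" using q by auto
  have ne: "\<not> (d = d' \<and> i = i' \<and> j = j')" using assms(3) * by auto
  have "d = 0 \<or> d = 1 \<or> d = 2" "d' = 0 \<or> d' = 1 \<or> d' = 2" using *(1,3) by auto
  moreover have "i' = i \<or> i' = i + 1 \<or> i' = i - 1" using X unfolding X_def by (auto split: if_splits)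
  moreover have "j' = j \<or> j' = j + 1 \<or> j' = j - 1" using Y unfolding Y_def by (auto split: if_splits)
  ultimately have "upv i j = upv i' j' \<or> dnv_at d i j = dnv_at d' i' j'"
    using X Y XY ne unfolding X_def Y_def by (elim disjE) (simp_all add: dnv_at_def)
  then show "\<exists>v. endpoint \<delta> m v \<and> endpoint \<delta> n v"
    unfolding * endpoint_mdpt_iff[OF *(1)] endpoint_mdpt_iff[OF *(3)] by metis
qed

section \<open>Polygonal paths\<close>

lemma endpoint_is_vertex: "endpoint \<delta> m v \<Longrightarrow> is_vertex v"
  unfolding is_vertex_def by blast

lemma vertex_not_mid_edge: "is_vertex v \<Longrightarrow> v \<notin> mid_edges \<delta>"
  using card_hexes_vertex card_hexes_mid_edge by fastforce

definition lattice_pt :: "complex \<Rightarrow> bool" where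
  "lattice_pt x \<longleftrightarrow> is_vertex x \<or> x \<in> mid_edges \<delta>"

lemma lattice_pt_hexes_inj: "lattice_pt x \<Longrightarrow> lattice_pt y \<Longrightarrow> hexes_at x = hexes_at y \<Longrightarrow> x = y"
proof -
  assume "lattice_pt x" "lattice_pt y" and e: "hexes_at x = hexes_at y"
  moreover have "card (hexes_at x) = card (hexes_at y)" using e by simp
  ultimately show "x = y"
    unfolding lattice_pt_def
    using card_hexes_vertex[of x] card_hexes_vertex[of y] card_hexes_mid_edge[of x] card_hexes_mid_edge[of y]
      hexes_at_vertex_inj[of x y] hexes_at_mid_edge_inj[of x y] by auto
qed

lemma half_edge_cases:
  assumes "half_edge \<delta> x y"
  obtains "endpoint \<delta> x y" "x \<in> mid_edges \<delta>" "is_vertex y" | "endpoint \<delta> y x" "y \<in> mid_edges \<delta>" "is_vertex x"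
  using assms endpoint_mid_edge endpoint_is_vertex unfolding half_edge_def by blast

lemma half_edge_lattice_pt: "half_edge \<delta> x y \<Longrightarrow> lattice_pt x \<and> lattice_pt y"
  by (elim half_edge_cases) (auto simp: lattice_pt_def)

lemma half_edge_sym: "half_edge \<delta> x y \<longleftrightarrow> half_edge \<delta> y x"
  by (auto simp: half_edge_def)

lemma hexes_at_half_edge_pt:
  assumes "half_edge \<delta> x y" "z \<in> closed_segment x y"
  shows "hexes_at z = hexes_at x \<and> (x \<in> mid_edges \<delta> \<or> z = x) \<or> hexes_at z = hexes_at y \<and> (y \<in> mid_edges \<delta> \<or> z = y)"
  using assms(1)
proof (cases rule: half_edge_cases)
  case 1
  then show ?thesis using hexes_at_half_edge[OF 1(1) assms(2)] by blast
next
  case 2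
  then show ?thesis using hexes_at_half_edge[OF 2(1)] assms(2) by (metis closed_segment_commute)
qed

text \<open>A one-element list satisfies \<open>successively\<close> at any point of the plane,
  which is why length one is treated separately.\<close>

lemma successively_half_edge_lattice:
  "successively (half_edge \<delta>) q \<Longrightarrow> length q \<noteq> 1 \<or> lattice_pt (hd q) \<Longrightarrow> x \<in> set q \<Longrightarrow> lattice_pt x"
proof (induction q rule: induct_list012)
  case (3 y z q)
  then show ?case using half_edge_lattice_pt[of y z] by (cases q) auto
qed auto

lemma polygonal_path_lattice:
  "polygonal_path \<delta> q \<Longrightarrow> lattice_pt (hd q) \<Longrightarrow> x \<in> set q \<Longrightarrow> lattice_pt x"
  using successively_half_edge_lattice unfolding polygonal_path_def by blast

lemma path_trace_Cons: "p \<noteq> [] \<Longrightarrow> path_trace (x # p) = closed_segment x (hd p) \<union> path_trace p"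
  by (cases p) auto

lemma path_trace_append:
  "path_trace (xs @ y # ys) = path_trace (xs @ [y]) \<union> path_trace (y # ys)"
proof (induction xs)
  case Nil
  then show ?case by (cases ys) auto
next
  case (Cons x xs)
  then show ?case by (cases xs) (auto simp: path_trace_Cons)
qed

lemma path_trace_rev: "path_trace (rev p) = path_trace p"
proof (induction p rule: path_trace.induct)
  case (3 x y p)
  have "path_trace (rev (x # y # p)) = path_trace (rev p @ [y]) \<union> path_trace [y, x]"
    using path_trace_append[of "rev p" y "[x]"] by simp
  then show ?case using 3 by (auto simp: closed_segment_commute)
qed auto

lemma set_subset_path_trace: "set p \<subseteq> path_trace p"
  by (induction p rule: path_trace.induct) auto

lemma path_trace_drop_subset: "path_trace (drop n p) \<subseteq> path_trace p"
proof (cases "n < length p")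
  case True
  then show ?thesis using path_trace_append[of "take n p" "p ! n" "drop (Suc n) p"]
    by (simp add: Cons_nth_drop_Suc id_take_nth_drop[symmetric])
qed simp

lemma path_connected_path_trace: "path_connected (path_trace p)"
proof (induction p rule: path_trace.induct)
  case (3 x y p)
  have "y \<in> path_trace (y # p)" using set_subset_path_trace by fastforce
  then show ?case using 3 by (auto intro!: path_connected_Un)
qed auto

text \<open>Along a half-edge, every point except the vertex lies in exactly the hexagons of the
  mid-edge. So the position of a trace relative to the hexagons can be read off from the
  list.\<close>

lemma path_trace_hexes:
  assumes "successively (half_edge \<delta>) q" "z \<in> path_trace q"
  shows "\<exists>x\<in>set q. hexes_at z = hexes_at x \<and> (x \<in> mid_edges \<delta> \<or> z = x)"
  using assms
proof (induction q rule: path_trace.induct)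
  case (3 x y p)
  then show ?case using hexes_at_half_edge_pt[of x y z] by auto
qed auto

text \<open>A common point of the traces has the hexagons of an entry of each list, and lattice
  points with equal hexagons coincide. This turns the geometric condition in
  \<open>allowable\<close> into one on lists.\<close>

lemma path_trace_disjoint:
  assumes "polygonal_path \<delta> p" "lattice_pt (hd p)" "polygonal_path \<delta> q" "lattice_pt (hd q)"
  shows "path_trace p \<inter> path_trace q = {} \<longleftrightarrow> set p \<inter> set q = {}"
proof
  assume "set p \<inter> set q = {}"
  then show "path_trace p \<inter> path_trace q = {}"
    using path_trace_hexes[of p] path_trace_hexes[of q] polygonal_path_lattice[OF assms(1,2)]
      polygonal_path_lattice[OF assms(3,4)] lattice_pt_hexes_inj assms(1,3)
    unfolding polygonal_path_def by (metis disjoint_iff)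
next
  assume "path_trace p \<inter> path_trace q = {}"
  then show "set p \<inter> set q = {}" using set_subset_path_trace by blast
qed

lemma path_trace_lattice_pt:
  assumes "polygonal_path \<delta> q" "lattice_pt (hd q)" "lattice_pt x" "x \<in> path_trace q"
  shows "x \<in> set q"
  using path_trace_hexes[of q x] assms polygonal_path_lattice[OF assms(1,2)] lattice_pt_hexes_inj
  unfolding polygonal_path_def by metis

lemma half_edge_subset_region:
  assumes "endpoint \<delta> m v" "m \<in> hex_region \<delta> D"
  shows "closed_segment m v \<subseteq> hex_region \<delta> D"
proof
  fix z assume "z \<in> closed_segment m v"
  then have "hexes_at m \<subseteq> hexes_at z"
    using hexes_at_half_edge[OF assms(1)] endpoint_hexes[OF assms(1)] by (cases "z = v") auto
  then show "z \<in> hex_region \<delta> D" using assms(2) unfolding mem_hex_region by blast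
qed

text \<open>Testing mid-edges suffices, because a hexagon that contains a mid-edge contains its
  half-edges. A one-element list has no half-edge and is tested itself.\<close>

lemma path_trace_subset_region:
  assumes "successively (half_edge \<delta>) q" "\<And>x. x \<in> set q \<Longrightarrow> x \<in> mid_edges \<delta> \<or> length q = 1 \<Longrightarrow> x \<in> hex_region \<delta> D"
  shows "path_trace q \<subseteq> hex_region \<delta> D"
  using assms
proof (induction q rule: path_trace.induct)
  case (3 x y p)
  have "closed_segment x y \<subseteq> hex_region \<delta> D"
  proof -
    have "half_edge \<delta> x y" using 3(2) by simp
    then show ?thesis
      by (cases rule: half_edge_cases) (use half_edge_subset_region[of x y D] half_edge_subset_region[of y x D] 3(3) in \<open>simp_all add: closed_segment_commute\<close>)
  qed
  moreover have "path_trace (y # p) \<subseteq> hex_region \<delta> D"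
  proof (rule 3(1))
    have "y \<in> hex_region \<delta> D" using \<open>closed_segment x y \<subseteq> hex_region \<delta> D\<close> by auto
    then show "z \<in> hex_region \<delta> D" if "z \<in> set (y # p)" "z \<in> mid_edges \<delta> \<or> length (y # p) = 1" for z
      using that 3(3)[of z] by (cases p) auto
  qed (use 3(2) in auto)
  ultimately show ?case by simp
qed auto

section \<open>Mid-edges on the boundary of a set of hexagons\<close>

text \<open>The edges are numbered by opposition: \<open>e1\<close> is the one that does not border
  \<open>h1\<close>, and so on.\<close>

lemma vertex_star:
  assumes "is_vertex x"
  obtains h1 h2 h3 e1 e2 e3 where "h1 \<noteq> h2" "h1 \<noteq> h3" "h2 \<noteq> h3" "hexes_at x = {h1, h2, h3}"
    "hexes_at e1 = {h2, h3}" "hexes_at e2 = {h1, h3}" "hexes_at e3 = {h1, h2}"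
    "e1 \<noteq> e2" "e1 \<noteq> e3" "e2 \<noteq> e3" "\<And>n. endpoint \<delta> n x \<longleftrightarrow> n \<in> {e1, e2, e3}"
proof -
  from card_hexes_vertex[OF assms] obtain h1 h2 h3 where h: "h1 \<noteq> h2" "h1 \<noteq> h3" "h2 \<noteq> h3" "hexes_at x = {h1, h2, h3}"
    unfolding card_3_iff by blast
  obtain e1 where e1: "endpoint \<delta> e1 x" "hexes_at e1 = {h2, h3}"
    using mid_edge_exists[OF assms, of h1] h by auto
  obtain e2 where e2: "endpoint \<delta> e2 x" "hexes_at e2 = {h1, h3}"
    using mid_edge_exists[OF assms, of h2] h by auto
  obtain e3 where e3: "endpoint \<delta> e3 x" "hexes_at e3 = {h1, h2}"
    using mid_edge_exists[OF assms, of h3] h by auto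
  have "n \<in> {e1, e2, e3}" if n: "endpoint \<delta> n x" for n
  proof -
    obtain k l where kl: "k \<noteq> l" "hexes_at n = {k, l}"
      using card_hexes_mid_edge[OF endpoint_mid_edge[OF n]] unfolding card_2_iff by blast
    moreover have "{k, l} \<subseteq> {h1, h2, h3}" using endpoint_hexes[OF n] h kl by simp
    ultimately have "hexes_at n = hexes_at e1 \<or> hexes_at n = hexes_at e2 \<or> hexes_at n = hexes_at e3"
      using e1 e2 e3 by auto
    then show ?thesis using n e1(1) e2(1) e3(1) endpoint_mid_edge hexes_at_mid_edge_inj by blast
  qed
  moreover have "e1 \<noteq> e2" "e1 \<noteq> e3" "e2 \<noteq> e3" using e1 e2 e3 h by auto
  ultimately show thesis using that[of h1 h2 h3 e1 e2 e3] h e1 e2 e3 by blast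
qed

definition straddles :: "(int \<times> int) set \<Rightarrow> complex \<Rightarrow> bool" where
  "straddles Q x \<longleftrightarrow> hexes_at x \<inter> Q \<noteq> {} \<and> \<not> hexes_at x \<subseteq> Q"

lemma straddles_endpoint: "straddles Q n \<Longrightarrow> endpoint \<delta> n x \<Longrightarrow> straddles Q x"
  using endpoint_hexes unfolding straddles_def by blast

text \<open>In a turn around the vertex, membership in \<open>Q\<close> changes an even number of
  times, and each change happens at one of the three edges.\<close>

lemma even_straddling_star:
  assumes "is_vertex x"
  shows "finite {n. endpoint \<delta> n x \<and> straddles Q n}" "even (card {n. endpoint \<delta> n x \<and> straddles Q n})"
    "card {n. endpoint \<delta> n x \<and> straddles Q n} \<le> 3"
proof -
  from vertex_star[OF assms] obtain h1 h2 h3 e1 e2 e3 where s: "h1 \<noteq> h2" "h1 \<noteq> h3" "h2 \<noteq> h3" "hexes_at x = {h1, h2, h3}"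
    "hexes_at e1 = {h2, h3}" "hexes_at e2 = {h1, h3}" "hexes_at e3 = {h1, h2}"
    "e1 \<noteq> e2" "e1 \<noteq> e3" "e2 \<noteq> e3" "\<And>n. endpoint \<delta> n x \<longleftrightarrow> n \<in> {e1, e2, e3}" by metis
  have e: "{n. endpoint \<delta> n x \<and> straddles Q n} = (if straddles Q e1 then {e1} else {}) \<union> (if straddles Q e2 then {e2} else {})
      \<union> (if straddles Q e3 then {e3} else {})"
    using s(11) by auto
  show "finite {n. endpoint \<delta> n x \<and> straddles Q n}" "card {n. endpoint \<delta> n x \<and> straddles Q n} \<le> 3"
    unfolding e using s(8-10) by auto
  show "even (card {n. endpoint \<delta> n x \<and> straddles Q n})"
    unfolding e unfolding straddles_def s(5-7) using s(8-10) by (cases "h1 \<in> Q"; cases "h2 \<in> Q"; cases "h3 \<in> Q") auto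
qed

text \<open>Both ends of a straddling mid-edge are corners of a hexagon in \<open>Q\<close>, and the
  ends determine the mid-edge.\<close>

lemma finite_straddling:
  assumes "finite Q"
  shows "finite {n \<in> mid_edges \<delta>. straddles Q n}"
proof -
  define V where "V = (\<Union>h\<in>Q. {v. is_vertex v \<and> h \<in> hexes_at v})"
  have "finite V" unfolding V_def using assms finite_vertices_hexagon by blast
  moreover have "{n \<in> mid_edges \<delta>. straddles Q n} \<subseteq> (\<lambda>(u, w). midpoint u w) ` (V \<times> V)"
  proof
    fix n assume "n \<in> {n \<in> mid_edges \<delta>. straddles Q n}"
    then have n: "n \<in> mid_edges \<delta>" "straddles Q n" by auto
    from n(1) obtain u w where "up_vertex u" "\<not> up_vertex w" and uw: "hexes_at u \<inter> hexes_at w = hexes_at n"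
      "n = midpoint u w" "{x. endpoint \<delta> n x} = {u, w}" by (rule mid_edge_endpoints)
    then have "is_vertex u" "is_vertex w" unfolding is_vertex_def by blast+
    then have "u \<in> V" "w \<in> V" using n(2) uw(1) unfolding V_def straddles_def by blast+
    then show "n \<in> (\<lambda>(u, w). midpoint u w) ` (V \<times> V)" using uw(2) by auto
  qed
  ultimately show ?thesis by (meson finite_SigmaI finite_imageI finite_subset)
qed

text \<open>Each edge has exactly one end of colour \<open>c\<close>, so the vertices of one colour
  count every edge once. Equating the counts for the two colours yields a parity constraint.\<close>

lemma handshake:
  assumes "finite K" "K \<subseteq> mid_edges \<delta>"
  shows "card K = (\<Sum>x | is_vertex x \<and> up_vertex x = c \<and> (\<exists>n\<in>K. endpoint \<delta> n x). card {n\<in>K. endpoint \<delta> n x})"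
    "finite {x. is_vertex x \<and> up_vertex x = c \<and> (\<exists>n\<in>K. endpoint \<delta> n x)}"
proof -
  let ?X = "{x. is_vertex x \<and> up_vertex x = c \<and> (\<exists>n\<in>K. endpoint \<delta> n x)}"
  have ex1: "\<exists>!x. endpoint \<delta> n x \<and> up_vertex x = c" if "n \<in> K" for n
  proof -
    have "n \<in> mid_edges \<delta>" using that assms(2) by blast
    then obtain u v where "up_vertex u" "\<not> up_vertex v" "hexes_at u \<inter> hexes_at v = hexes_at n"
      "n = midpoint u v" "{x. endpoint \<delta> n x} = {u, v}" by (rule mid_edge_endpoints)
    then show ?thesis by (cases c) (auto simp: set_eq_iff)
  qed
  have "?X = (\<lambda>n. THE x. endpoint \<delta> n x \<and> up_vertex x = c) ` K"
  proof (intro equalityI subsetI)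
    fix x assume "x \<in> ?X"
    then obtain n where n: "n \<in> K" "endpoint \<delta> n x" "up_vertex x = c" by auto
    then have "(THE x. endpoint \<delta> n x \<and> up_vertex x = c) = x" using ex1[OF n(1)] by (intro the1_equality) auto
    then show "x \<in> (\<lambda>n. THE x. endpoint \<delta> n x \<and> up_vertex x = c) ` K" using n(1) by blast
  next
    fix x assume "x \<in> (\<lambda>n. THE x. endpoint \<delta> n x \<and> up_vertex x = c) ` K"
    then obtain n where n: "n \<in> K" "x = (THE x. endpoint \<delta> n x \<and> up_vertex x = c)" by blast
    then have "endpoint \<delta> n x \<and> up_vertex x = c" using theI'[OF ex1[OF n(1)]] by simp
    then show "x \<in> ?X" using n(1) endpoint_is_vertex by auto
  qed
  then show fin: "finite ?X" using assms(1) by simp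
  have "n \<in> (\<Union>x\<in>?X. {n\<in>K. endpoint \<delta> n x})" if n: "n \<in> K" for n
  proof -
    obtain x where "endpoint \<delta> n x" "up_vertex x = c" using ex1[OF n] by auto
    then show ?thesis using n endpoint_is_vertex[of n x] by auto
  qed
  then have "K = (\<Union>x\<in>?X. {n\<in>K. endpoint \<delta> n x})" by auto
  then have "card K = card (\<Union>x\<in>?X. {n\<in>K. endpoint \<delta> n x})" by simp
  also have "\<dots> = (\<Sum>x\<in>?X. card {n\<in>K. endpoint \<delta> n x})"
    using fin
  proof (rule card_UN_disjoint)
    show "\<forall>x\<in>?X. finite {n\<in>K. endpoint \<delta> n x}" using assms(1) by simp
    show "\<forall>x\<in>?X. \<forall>y\<in>?X. x \<noteq> y \<longrightarrow> {n\<in>K. endpoint \<delta> n x} \<inter> {n\<in>K. endpoint \<delta> n y} = {}"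
    proof (intro ballI impI)
      fix x y assume "x \<in> ?X" "y \<in> ?X" "x \<noteq> y"
      then have "\<not> (endpoint \<delta> n x \<and> endpoint \<delta> n y)" if "n \<in> K" for n using ex1[OF that] by auto
      then show "{n\<in>K. endpoint \<delta> n x} \<inter> {n\<in>K. endpoint \<delta> n y} = {}" by auto
    qed
  qed
  finally show "card K = (\<Sum>x\<in>?X. card {n\<in>K. endpoint \<delta> n x})" .
qed

text \<open>The mid-edges straddling the boundary of \<open>Q\<close> form a graph with even degrees. If \<open>m2\<close> could not be
  reached from \<open>m1\<close> without passing through \<open>v\<close>, then \<open>v\<close> would be the only vertex of odd degree in the
  component of \<open>m1\<close>, which contradicts the handshake lemma in the bipartite hexagonal lattice.\<close>

lemma straddling_path:
  assumes fin: "finite Q" and m1: "endpoint \<delta> m1 v" "straddles Q m1" and m2: "endpoint \<delta> m2 v" "straddles Q m2"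
    and ne: "m1 \<noteq> m2"
  obtains q where "polygonal_path \<delta> q" "hd q = m1" "last q = m2" "v \<notin> set q" "\<forall>x\<in>set q. straddles Q x"
proof -
  \<comment> \<open>Moves pass only through vertices other than \<open>v\<close>, so
    \<open>K\<close> is the component of \<open>m1\<close> after the edges at \<open>v\<close> have
    been detached from one another.\<close>
  define step where "step n n' \<longleftrightarrow> straddles Q n' \<and> (\<exists>x. x \<noteq> v \<and> endpoint \<delta> n x \<and> endpoint \<delta> n' x)" for n n'
  define K where "K = {n. step\<^sup>*\<^sup>* m1 n}"
  have K_mid: "n \<in> mid_edges \<delta> \<and> straddles Q n" if "n \<in> K" for n
    using that m1 endpoint_mid_edge unfolding K_def step_def mem_Collect_eq by (induction rule: rtranclp_induct) auto
  have K_step: "n' \<in> K" if "n \<in> K" "endpoint \<delta> n x" "endpoint \<delta> n' x" "x \<noteq> v" "straddles Q n'" for n n' x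
  proof -
    have "step n n'" unfolding step_def using that by blast
    then show ?thesis using that(1) unfolding K_def by auto
  qed
  have finK: "finite K" using finite_subset[OF _ finite_straddling[OF fin]] K_mid by blast
  have "m2 \<in> K"
  proof (rule ccontr)
    assume m2K: "m2 \<notin> K"
    \<comment> \<open>Away from \<open>v\<close>, the component contains either all straddling edges
      at a vertex or none of them.\<close>
    have ev: "even (card {n\<in>K. endpoint \<delta> n x})" if "is_vertex x" "x \<noteq> v" for x
    proof (cases "\<exists>n\<in>K. endpoint \<delta> n x")
      case True
      then have "{n\<in>K. endpoint \<delta> n x} = {n. endpoint \<delta> n x \<and> straddles Q n}"
        using K_mid K_step that(2) by blast
      then show ?thesis using even_straddling_star[OF that(1)] by simp
    next
      case False
      then have "{n\<in>K. endpoint \<delta> n x} = {}" by blast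
      then show ?thesis by (metis card.empty even_zero)
    qed
    have v: "is_vertex v" using m1(1) endpoint_is_vertex by blast
    have m1K: "m1 \<in> K" by (simp add: K_def)
    \<comment> \<open>By parity and the bound 3, the straddling edges at \<open>v\<close> are
      exactly \<open>m1\<close> and \<open>m2\<close>, and only the first is in
      \<open>K\<close>.\<close>
    have cv: "card {n\<in>K. endpoint \<delta> n v} = 1"
    proof -
      let ?B = "{n. endpoint \<delta> n v \<and> straddles Q n}"
      have "{m1, m2} \<subseteq> ?B" using m1 m2 by blast
      then have "card {m1, m2} \<le> card ?B" using even_straddling_star(1)[OF v] by (rule card_mono[rotated])
      moreover have "card ?B \<noteq> 3" using even_straddling_star(2)[OF v, of Q] by (metis odd_numeral)
      ultimately have "card {m1, m2} = card ?B" using even_straddling_star(3)[OF v, of Q] ne by simp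
      then have "?B = {m1, m2}" using card_subset_eq[OF even_straddling_star(1)[OF v] \<open>{m1, m2} \<subseteq> ?B\<close>] by simp
      then have "{n\<in>K. endpoint \<delta> n v} = {m1}" using m1K m2K K_mid m1(1) by blast
      then show ?thesis by simp
    qed
    \<comment> \<open>Counted from the colour opposite to \<open>v\<close> the number of edges is
      even; counted from the colour of \<open>v\<close> it is odd.\<close>
    have Kmid: "K \<subseteq> mid_edges \<delta>" using K_mid by blast
    have "even (card K)"
      using handshake(1)[OF finK Kmid, of "\<not> up_vertex v"] ev by (auto intro!: dvd_sum)
    moreover have "odd (card K)"
    proof -
      let ?X = "{x. is_vertex x \<and> up_vertex x = up_vertex v \<and> (\<exists>n\<in>K. endpoint \<delta> n x)}"
      have "v \<in> ?X" using v m1K m1(1) by blast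
      then have "card K = card {n\<in>K. endpoint \<delta> n v} + (\<Sum>x\<in>?X - {v}. card {n\<in>K. endpoint \<delta> n x})"
        by (rule trans[OF handshake(1)[OF finK Kmid] sum.remove[OF handshake(2)[OF finK Kmid]]])
      moreover have "even (\<Sum>x\<in>?X - {v}. card {n\<in>K. endpoint \<delta> n x})" using ev by (intro dvd_sum) auto
      ultimately show ?thesis using cv by simp
    qed
    ultimately show False by blast
  qed
  moreover have "\<exists>q. polygonal_path \<delta> q \<and> hd q = m1 \<and> last q = n \<and> v \<notin> set q \<and> (\<forall>x\<in>set q. straddles Q x)"
    if "step\<^sup>*\<^sup>* m1 n" for n
    using that
  proof (induction rule: rtranclp_induct)
    case base
    have "v \<noteq> m1" using m1(1) vertex_not_mid_edge endpoint_mid_edge endpoint_is_vertex by blast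
    then show ?case using m1 by (intro exI[of _ "[m1]"]) (auto simp: polygonal_path_def)
  next
    case (step n n')
    then obtain q where q: "polygonal_path \<delta> q" "hd q = m1" "last q = n" "v \<notin> set q" "\<forall>x\<in>set q. straddles Q x" by blast
    from step(2) obtain x where x: "straddles Q n'" "x \<noteq> v" "endpoint \<delta> n x" "endpoint \<delta> n' x" unfolding step_def by blast
    have "v \<noteq> n'" using x m1(1) vertex_not_mid_edge endpoint_mid_edge endpoint_is_vertex by blast
    then show ?case using q x straddles_endpoint[OF x(1,4)]
      by (intro exI[of _ "q @ [x, n']"]) (auto simp: polygonal_path_def successively_append_iff half_edge_def)
  qed
  ultimately show thesis using that unfolding K_def by blast
qed

section \<open>Winding numbers around hexagon centres\<close>

lemma card_hexes_lattice_pt: "lattice_pt x \<Longrightarrow> 2 \<le> card (hexes_at x)"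
  using card_hexes_vertex card_hexes_mid_edge unfolding lattice_pt_def by fastforce

text \<open>Lattice paths run along hexagon boundaries. This is what lets a test point for winding
  numbers move freely inside a hexagon.\<close>

lemma path_trace_not_singleton:
  assumes "polygonal_path \<delta> r" "lattice_pt (hd r)" "z \<in> path_trace r"
  shows "hexes_at z \<noteq> {h}"
proof -
  obtain x where "x \<in> set r" "hexes_at z = hexes_at x"
    using path_trace_hexes[of r z] assms unfolding polygonal_path_def by blast
  then have "2 \<le> card (hexes_at z)"
    using polygonal_path_lattice[OF assms(1,2)] card_hexes_lattice_pt by metis
  then show ?thesis by auto
qed

text \<open>The two halves of an edge lie in the same hexagons, so \<open>path_trace_hexes\<close>
  cannot tell them apart. This form keeps track of the half-edge.\<close>

lemma path_trace_half_edge: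
  assumes "successively (half_edge \<delta>) q" "z \<in> path_trace q"
  shows "z \<in> set q \<or> (\<exists>n\<in>set q. \<exists>w\<in>set q. endpoint \<delta> n w \<and> z \<in> closed_segment n w)"
  using assms
proof (induction q rule: path_trace.induct)
  case (3 x y p)
  show ?case
  proof (cases "z \<in> closed_segment x y")
    case True
    have "half_edge \<delta> x y" using 3 by simp
    then show ?thesis using True unfolding half_edge_def by (auto simp: closed_segment_commute)
  qed (use 3 in auto)
qed auto

text \<open>The segments from \<open>w\<close> to the two centres form a connected set off the loop:
  away from \<open>w\<close> their points lie in a single hexagon, and points of a lattice path
  never do.\<close>

lemma winding_number_around_pt:
  assumes "path C" "pathfinish C = pathstart C" "path_image C \<subseteq> path_trace r"
    "polygonal_path \<delta> r" "lattice_pt (hd r)" "w \<notin> path_image C" "h \<in> hexes_at w" "h' \<in> hexes_at w"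
  shows "winding_number C (hex_center \<delta> h) = winding_number C (hex_center \<delta> h')"
proof (rule winding_number_eq[OF assms(1,2)])
  let ?S = "closed_segment (hex_center \<delta> h) w \<union> closed_segment (hex_center \<delta> h') w"
  show "hex_center \<delta> h \<in> ?S" "hex_center \<delta> h' \<in> ?S" by auto
  show "connected ?S" by (intro connected_Un) auto
  have "z \<notin> path_image C" if "z \<in> closed_segment (hex_center \<delta> k) w" "k \<in> hexes_at w" for z k
  proof (cases "z = w")
    case False
    then have "hexes_at z = {k}" using hexes_at_center_segment that unfolding mem_hexes_at by blast
    then show ?thesis using path_trace_not_singleton[OF assms(4,5)] assms(3) by blast
  qed (use assms(6) in simp)
  then show "?S \<inter> path_image C = {}" using assms(7,8) by blast
qed

text \<open>The half-edge from \<open>v\<close> to \<open>m1\<close> is replaced by the detour through the centre of \<open>F\<close>. The new loop no longer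
  separates \<open>F\<close> from \<open>L\<close> near the half-edge, and the two loops differ by a triangle that winds once
  around points of \<open>F\<close> and not at all around the centre of \<open>L\<close>.\<close>

lemma winding_number_jump:
  assumes m1: "endpoint \<delta> m1 v" and m2: "endpoint \<delta> m2 v" and ne: "m1 \<noteq> m2"
    and q: "polygonal_path \<delta> q" "hd q = m1" "v \<notin> set q"
    and g: "path g" "pathstart g = m1" "pathfinish g = m2" "path_image g \<subseteq> path_trace q"
    and F: "hexes_at m1 = {F, L}" "F \<noteq> L"
  shows "winding_number (linepath v m1 +++ g +++ linepath m2 v) (hex_center \<delta> F) \<noteq>
    winding_number (linepath v m1 +++ g +++ linepath m2 v) (hex_center \<delta> L)"
proof -
  \<comment> \<open>\<open>p\<close> is the centroid of the triangle with corners \<open>v\<close>,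
    \<open>m1\<close>, \<open>c\<close>. It lies on the segment from \<open>c\<close> to the
    midpoint \<open>x\<close> of the half-edge, which is the route along which the test point passes
    from \<open>F\<close> to \<open>L\<close>.\<close>
  define c x p where "c = hex_center \<delta> F" and "x = midpoint v m1" and "p = (1/3) *\<^sub>R v + (1/3) *\<^sub>R m1 + (1/3) *\<^sub>R c"
  define G where "G = g +++ linepath m2 v"
  \<comment> \<open>\<open>C\<close> is the loop, \<open>T\<close> the triangle over the half-edge,
    and \<open>B\<close> the loop after the detour.\<close>
  define C where "C = linepath v m1 +++ G"
  define T where "T = linepath v m1 +++ linepath m1 c +++ linepath c v"
  define B where "B = (linepath v c +++ linepath c m1) +++ G"
  have vm1: "v \<noteq> m1" using m1 vertex_not_mid_edge endpoint_mid_edge endpoint_is_vertex by blast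
  have hv: "card (hexes_at v) = 3" using m1 card_hexes_vertex endpoint_is_vertex by blast
  have Fv: "v \<in> hexagon \<delta> F" "m1 \<in> hexagon \<delta> F" using endpoint_hexes[OF m1] F(1) unfolding mem_hexes_at[symmetric] by auto
  have xseg: "x \<in> closed_segment m1 v" "x \<noteq> v" "x \<noteq> m1"
    using vm1 unfolding x_def by (metis closed_segment_commute midpoint_in_closed_segment, simp_all)
  have hx: "hexes_at x = {F, L}" using hexes_at_half_edge[OF m1 xseg(1,2)] F by simp
  have xF: "x \<in> hexagon \<delta> F" using hx mem_hexes_at by blast
  have cv: "hexes_at z = {F}" if "z \<in> closed_segment c v" "z \<noteq> v" for z
    using hexes_at_center_segment[OF Fv(1)] that c_def by blast
  have cm: "hexes_at z = {F}" if "z \<in> closed_segment c m1" "z \<noteq> m1" for z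
    using hexes_at_center_segment[OF Fv(2)] that c_def by blast
  have cx: "hexes_at z = {F}" if "z \<in> closed_segment c x" "z \<noteq> x" for z
    using hexes_at_center_segment[OF xF] that c_def by blast
  have Lx: "hexes_at z = {L}" if "z \<in> closed_segment (hex_center \<delta> L) x" "z \<noteq> x" for z
    using hexes_at_center_segment[of x L] that hx mem_hexes_at by blast
  have vmseg: "hexes_at z = {F, L}" if "z \<in> closed_segment v m1" "z \<noteq> v" for z
    using hexes_at_half_edge[OF m1 _ that(2)] that(1) F(1) by (simp add: closed_segment_commute)
  have hc: "hexes_at c = {F}" by (simp add: c_def hexes_at_center)
  have hL: "hexes_at (hex_center \<delta> L) = {L}" by (simp add: hexes_at_center)
  have hLv: "hex_center \<delta> L \<noteq> v" "hex_center \<delta> L \<noteq> m1" using hL hv F by auto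
  \<comment> \<open>No corner lies between the other two: points between \<open>c\<close> and
    another corner lie in \<open>F\<close> alone, points of the half-edge in at least two
    hexagons.\<close>
  have ncol: "\<not> collinear {v, m1, c}"
  proof
    assume "collinear {v, m1, c}"
    then consider "v \<in> closed_segment c m1" | "m1 \<in> closed_segment c v" | "c \<in> closed_segment v m1"
      unfolding collinear_between_cases between_mem_segment by (metis closed_segment_commute)
    then show False
    proof cases
      case 1
      then show False using cm[OF 1] vm1 hv by auto
    next
      case 2
      then show False using cv[OF 2] vm1 F by auto
    next
      case 3
      then show False using vmseg[OF 3] hc F hv by (cases "c = v") auto
    qed
  qed
  have inter: "interior (convex hull {v, m1, c}) =
      {z. \<exists>a b d. 0 < a \<and> 0 < b \<and> 0 < d \<and> a + b + d = 1 \<and> a *\<^sub>R v + b *\<^sub>R m1 + d *\<^sub>R c = z}"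
    by (rule interior_convex_hull_3_minimal[OF ncol]) simp
  have off: "z \<notin> closed_segment v m1" "z \<notin> closed_segment m1 c" "z \<notin> closed_segment c v"
    if "z \<in> interior (convex hull {v, m1, c})" for z
    using that interior_of_triangle[of v m1 c] by auto
  \<comment> \<open>All three barycentric coordinates are positive; the one at \<open>c\<close> is
    \<open>(1 - t) / 3\<close> and vanishes only at \<open>x\<close>.\<close>
  have px: "z \<in> interior (convex hull {v, m1, c})" if z: "z \<in> closed_segment p x" "z \<noteq> x" for z
  proof -
    obtain t where t: "0 \<le> t" "t \<le> 1" "z = (1 - t) *\<^sub>R p + t *\<^sub>R x" using z(1) by (auto simp: closed_segment_def)
    have "t < 1" using t z(2) by (cases "t = 1") auto
    moreover have "z = ((1 - t) / 3 + t / 2) *\<^sub>R v + ((1 - t) / 3 + t / 2) *\<^sub>R m1 + ((1 - t) / 3) *\<^sub>R c"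
      unfolding t(3) p_def x_def midpoint_def by (simp add: complex_eq_iff field_simps)
    ultimately show ?thesis unfolding inter mem_Collect_eq
      by (intro exI[of _ "(1 - t) / 3 + t / 2"] exI[of _ "(1 - t) / 3"]) (use t in \<open>auto simp: field_simps\<close>)
  qed
  \<comment> \<open>The centroid divides the median from \<open>c\<close> to \<open>x\<close> at two
    thirds.\<close>
  have pcx: "p \<in> closed_segment c x"
    unfolding closed_segment_def mem_Collect_eq p_def x_def midpoint_def
    by (intro exI[of _ "2/3"]) (simp add: algebra_simps)
  have pnx: "p \<noteq> x"
  proof
    assume "p = x"
    then have "c = x" by (simp add: p_def x_def midpoint_def complex_eq_iff)
    then show False using hc hx F by auto
  qed
  have hp: "hexes_at p = {F}" by (rule cx[OF pcx pnx])
  have pint: "p \<in> interior (convex hull {v, m1, c})" by (rule px) (use pnx in auto)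
  have qne: "q \<noteq> []" and qs: "successively (half_edge \<delta>) q" using q(1) by (auto simp: polygonal_path_def)
  have Gimg: "path_image G \<subseteq> path_trace q \<union> closed_segment m2 v"
    unfolding G_def using g by (auto simp: path_image_join)
  have Gcard: "hexes_at z \<noteq> {h}" if "z \<in> path_image G" for z h
  proof -
    have "lattice_pt (hd q)" unfolding q(2) lattice_pt_def using endpoint_mid_edge[OF m1] by simp
    moreover have "hexes_at z \<noteq> {h}" if "z \<in> closed_segment m2 v"
      using hexes_at_half_edge[OF m2 that] card_hexes_mid_edge[OF endpoint_mid_edge[OF m2]] hv by (cases "z = v") auto
    ultimately show ?thesis using that Gimg path_trace_not_singleton[OF q(1)] by blast
  qed
  \<comment> \<open>A return to \<open>x\<close> would have to use the edge of \<open>m1\<close>.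
    The path \<open>q\<close> may contain the other half of this edge but not this half, because it
    avoids \<open>v\<close>; and \<open>m2\<close> lies on another edge.\<close>
  have Gx: "x \<notin> path_image G"
  proof
    assume "x \<in> path_image G"
    then consider "x \<in> path_trace q" | "x \<in> closed_segment m2 v" using Gimg by blast
    then show False
    proof cases
      case 1
      then consider "x \<in> set q" | n w where "n \<in> set q" "w \<in> set q" "endpoint \<delta> n w" "x \<in> closed_segment n w"
        using path_trace_half_edge[OF qs] by blast
      then show False
      proof cases
        case 1
        have "lattice_pt m1" using endpoint_mid_edge[OF m1] by (simp add: lattice_pt_def)
        then have "lattice_pt (hd q)" "lattice_pt m1" by (simp_all add: q(2))
        then show False using lattice_pt_hexes_inj[OF polygonal_path_lattice[OF q(1) _ 1], of m1] hx F(1) xseg(3) by simp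
      next
        case 2
        have "x \<noteq> w" using card_hexes_vertex[OF endpoint_is_vertex[OF 2(3)]] hx F(2) by auto
        then have "hexes_at n = hexes_at m1" using trans[OF hexes_at_half_edge[OF 2(3,4), symmetric] hx] F(1) by blast
        then have "n = m1" by (rule hexes_at_mid_edge_inj[OF endpoint_mid_edge[OF 2(3)] endpoint_mid_edge[OF m1]])
        have "w \<noteq> v" using 2(2) q(3) by blast
        have "m1 = midpoint v w" using two_endpoints(1)[OF m1, of w] 2(3) \<open>n = m1\<close> \<open>w \<noteq> v\<close> by simp
        then have "closed_segment v m1 \<inter> closed_segment m1 w = {m1}"
          by (intro Int_closed_segment disjI1) auto
        then show False using 2(4) \<open>n = m1\<close> xseg by (auto simp: closed_segment_commute)
      qed
    next
      case 2
      then have "hexes_at m2 = hexes_at m1" using hexes_at_half_edge[OF m2 2 xseg(2)] hx F(1) by simp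
      then show False using hexes_at_mid_edge_inj endpoint_mid_edge m1 m2 ne by blast
    qed
  qed
  have paths: "path G" "pathstart G = m1" "pathfinish G = v" using g by (auto simp: G_def)
  \<comment> \<open>The sides of the triangle at \<open>c\<close> are traversed in opposite
    directions by \<open>T\<close> and \<open>B\<close> and cancel.\<close>
  have sum: "winding_number C z = winding_number T z + winding_number B z"
    if "z \<notin> closed_segment v m1" "z \<notin> closed_segment m1 c" "z \<notin> closed_segment c v" "z \<notin> path_image G" for z
  proof -
    have s: "z \<notin> closed_segment c m1" "z \<notin> closed_segment v c" using that closed_segment_commute by metis+
    have "winding_number C z = winding_number (linepath v m1) z + winding_number G z"
      unfolding C_def using that paths by (subst winding_number_join) auto
    moreover have "winding_number T z = winding_number (linepath v m1) z + (winding_number (linepath m1 c) z + winding_number (linepath c v) z)"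
      unfolding T_def using that by (simp add: winding_number_join path_image_join)
    moreover have "winding_number B z = winding_number (linepath v c) z + winding_number (linepath c m1) z + winding_number G z"
      unfolding B_def using that s paths by (simp add: winding_number_join path_image_join)
    moreover have "winding_number (linepath v c) z = - winding_number (linepath c v) z"
      using winding_number_reversepath[of "linepath c v" z] that by simp
    moreover have "winding_number (linepath c m1) z = - winding_number (linepath m1 c) z"
      using winding_number_reversepath[of "linepath m1 c" z] that by simp
    ultimately show ?thesis by simp
  qed
  \<comment> \<open>From \<open>c\<close> to \<open>p\<close> the test point stays inside
    \<open>F\<close>, where \<open>C\<close> never goes.\<close>
  have "winding_number C c = winding_number C p"
  proof (rule winding_number_eq[of _ _ "closed_segment c p"])
    have "z \<notin> path_image C" if "z \<in> closed_segment c p" for z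
    proof -
      have "z \<in> closed_segment c x" using that pcx by (meson closed_segment_subset convex_closed_segment ends_in_segment(1) subsetD)
      moreover have "z \<noteq> x"
      proof
        assume "z = x"
        then have "x = p" using that pcx by (metis between_antisym between_commute between_mem_segment)
        then show False using pnx by simp
      qed
      ultimately have "hexes_at z = {F}" by (rule cx)
      moreover have "hexes_at z \<noteq> {F}" if "z \<in> closed_segment v m1"
        using vmseg[OF that] hv F(2) by (cases "z = v") auto
      ultimately show ?thesis using Gcard[of z F] unfolding C_def by (auto simp: path_image_join paths)
    qed
    then show "closed_segment c p \<inter> path_image C = {}" by blast
  qed (use paths in \<open>auto simp: C_def\<close>)
  also have "\<dots> = winding_number T p + winding_number B p"
    using off[OF pint] Gcard[of p F] hp by (intro sum) auto
  \<comment> \<open>\<open>B\<close> does not use the half-edge, so the test point can cross it at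
    \<open>x\<close> and go on to the centre of \<open>L\<close>.\<close>
  also have "winding_number B p = winding_number B (hex_center \<delta> L)"
  proof (rule winding_number_eq[of _ _ "closed_segment p x \<union> closed_segment (hex_center \<delta> L) x"])
    have imB: "path_image B = closed_segment v c \<union> closed_segment c m1 \<union> path_image G"
      unfolding B_def by (simp add: path_image_join paths)
    have 0: "x \<notin> path_image B"
      unfolding imB using Gx cv[of x] cm[of x] hx F(2) xseg by (auto simp: closed_segment_commute)
    have 1: "z \<notin> path_image B" if "z \<in> closed_segment p x" "z \<noteq> x" for z
    proof -
      have "z \<in> closed_segment c x" using that(1) pcx by (meson closed_segment_subset convex_closed_segment ends_in_segment(2) subsetD)
      then have "hexes_at z = {F}" using that(2) by (rule cx)
      then show ?thesis unfolding imB using Gcard[of z F] off[OF px[OF that]] by (auto simp: closed_segment_commute)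
    qed
    have 2: "z \<notin> path_image B" if "z \<in> closed_segment (hex_center \<delta> L) x" "z \<noteq> x" for z
    proof -
      have "z \<noteq> v" using Lx[OF that] hv by auto
      then show ?thesis
        unfolding imB using Lx[OF that] cv[of z] cm[of z] Gcard[of z L] F by (auto simp: closed_segment_commute)
    qed
    show "(closed_segment p x \<union> closed_segment (hex_center \<delta> L) x) \<inter> path_image B = {}"
      using 0 1 2 by blast
    show "connected (closed_segment p x \<union> closed_segment (hex_center \<delta> L) x)" by (intro connected_Un) auto
  qed (use paths in \<open>auto simp: B_def\<close>)
  also have "winding_number B (hex_center \<delta> L) = winding_number C (hex_center \<delta> L) - winding_number T (hex_center \<delta> L)"
  proof -
    have "hex_center \<delta> L \<notin> closed_segment v m1" "hex_center \<delta> L \<notin> closed_segment m1 c"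
      "hex_center \<delta> L \<notin> closed_segment c v" "hex_center \<delta> L \<notin> path_image G"
      using vmseg[of "hex_center \<delta> L"] cv[of "hex_center \<delta> L"] cm[of "hex_center \<delta> L"] Gcard[of "hex_center \<delta> L" L] hL hLv F
      by (auto simp: closed_segment_commute)
    then show ?thesis using sum[of "hex_center \<delta> L"] by simp
  qed
  also have "winding_number T (hex_center \<delta> L) = 0"
  proof (rule winding_number_zero_outside[OF _ convex_hexagon[of F]])
    show "hex_center \<delta> L \<notin> hexagon \<delta> F" using hL F(2) unfolding mem_hexes_at[symmetric] by auto
    have "c \<in> hexagon \<delta> F" unfolding c_def by (rule hex_center_in)
    then show "path_image T \<subseteq> hexagon \<delta> F"
      unfolding T_def using Fv convex_hexagon[of F] by (simp add: path_image_join closed_segment_subset)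
  qed (auto simp: T_def)
  finally have "winding_number C c = winding_number T p + winding_number C (hex_center \<delta> L)" by simp
  moreover have "winding_number T p \<noteq> 0"
    using winding_number_triangle[OF pint] unfolding T_def by auto
  ultimately show ?thesis unfolding C_def G_def c_def by auto
qed

text \<open>The complement of the domain counts as a single additional hexagon \<open>None\<close>.\<close>

definition hex_class :: "(int \<times> int) set \<Rightarrow> int \<times> int \<Rightarrow> (int \<times> int) option" where
  "hex_class D h = (if h \<in> D then Some h else None)"

lemma winding_number_outside:
  assumes "simply_connected (hex_region \<delta> D)" "path C" "pathfinish C = pathstart C"
    "path_image C \<subseteq> hex_region \<delta> D" "h \<notin> D"
  shows "winding_number C (hex_center \<delta> h) = 0"
  using assms(1,2,4,3)
proof (rule simply_connected_imp_winding_number_zero)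
  show "hex_center \<delta> h \<notin> hex_region \<delta> D" using assms(5) by (simp add: mem_hex_region hexes_at_center)
qed

section \<open>The dichotomy at a vertex: a hexagon already seen blocks one move\<close>

lemma hexagon_ahead:
  assumes "endpoint \<delta> m v"
  obtains F where "F \<notin> hexes_at m" "hexes_at v = insert F (hexes_at m)"
proof -
  have "card (hexes_at m) = 2" "card (hexes_at v) = 3"
    using assms card_hexes_mid_edge card_hexes_vertex endpoint_mid_edge endpoint_is_vertex by blast+
  moreover from this have "finite (hexes_at m)" using card.infinite by fastforce
  ultimately have "card (hexes_at v - hexes_at m) = 1" using endpoint_hexes[OF assms] by (simp add: card_Diff_subset)
  then obtain F where "hexes_at v - hexes_at m = {F}" by (rule card_1_singletonE)
  then show thesis using that[of F] endpoint_hexes[OF assms] by auto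
qed

text \<open>The hexagons at \<open>v\<close> other than \<open>F\<close> are those of
  \<open>m\<close>, so an edge at \<open>v\<close> not bordering \<open>F\<close> would have the
  same hexagons as \<open>m\<close> and coincide with it.\<close>

lemma mid_edge_ahead:
  assumes "endpoint \<delta> m v" "endpoint \<delta> m1 v" "m \<noteq> m1" "F \<in> hexes_at v - hexes_at m"
  obtains L where "hexes_at m1 = {F, L}" "F \<noteq> L" "L \<in> hexes_at m"
proof -
  have c: "card (hexes_at m) = 2" "card (hexes_at m1) = 2"
    using assms(1,2) card_hexes_mid_edge endpoint_mid_edge by blast+
  have fin: "finite (hexes_at m)" using c card.infinite by fastforce
  obtain F' where "F' \<notin> hexes_at m" "hexes_at v = insert F' (hexes_at m)" by (rule hexagon_ahead[OF assms(1)])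
  then have v: "hexes_at v = insert F (hexes_at m)" using assms(4) by auto
  have sub: "hexes_at m1 \<subseteq> hexes_at v" by (rule endpoint_hexes[OF assms(2)])
  have "F \<in> hexes_at m1"
  proof (rule ccontr)
    assume "F \<notin> hexes_at m1"
    then have "hexes_at m1 \<subseteq> hexes_at m" using sub v by auto
    then have "hexes_at m1 = hexes_at m" using card_subset_eq[OF fin] c by simp
    then show False using hexes_at_mid_edge_inj endpoint_mid_edge assms(1-3) by blast
  qed
  moreover obtain k l where kl: "hexes_at m1 = {k, l}" "k \<noteq> l" using c(2) unfolding card_2_iff by blast
  ultimately consider "F = k" | "F = l" by auto
  then show thesis
  proof cases
    case 1
    have "l \<in> hexes_at m" using sub 1 kl unfolding v by auto
    then show thesis using that[of l] 1 kl by simp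
  next
    case 2
    have "k \<in> hexes_at m" using sub 2 kl unfolding v by auto
    then show thesis using that[of k] 2 kl by (simp add: insert_commute)
  qed
qed

text \<open>\<open>vs\<close> lists the earlier vertices. Winding numbers agree among the hexagons
  at each of them; overlaps between consecutive vertices, and between the last one and
  \<open>m\<close>, carry the common value to the neighbour \<open>L\<close> of \<open>F\<close>.
  Since the value jumps from \<open>L\<close> to \<open>F\<close>, no seen hexagon equals
  \<open>F\<close>, and none is outside together with \<open>F\<close>, because both would then have
  value 0.\<close>

lemma visited_hexagon_separates:
  assumes sc: "simply_connected (hex_region \<delta> D)"
    and m: "endpoint \<delta> m v" "endpoint \<delta> m1 v" "endpoint \<delta> m2 v" "m1 \<noteq> m2" "m \<noteq> m1" "m \<noteq> m2"
    and q: "polygonal_path \<delta> q" "hd q = m1" "last q = m2" "v \<notin> set q" "path_trace q \<subseteq> hex_region \<delta> D"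
    and vs: "vs \<noteq> []" "\<And>w. w \<in> set vs \<Longrightarrow> is_vertex w \<and> w \<noteq> v \<and> w \<notin> set q"
      "successively (\<lambda>x y. hexes_at x \<inter> hexes_at y \<noteq> {}) vs" "hexes_at m \<subseteq> hexes_at (last vs)"
    and F: "F \<in> hexes_at v - hexes_at m"
  shows "hex_class D F \<notin> hex_class D ` (\<Union>w\<in>set vs. hexes_at w)"
proof
  assume mem: "hex_class D F \<in> hex_class D ` (\<Union>w\<in>set vs. hexes_at w)"
  obtain L where L: "hexes_at m1 = {F, L}" "F \<noteq> L" "L \<in> hexes_at m"
    using mid_edge_ahead[OF m(1,2,5) F] by metis
  have "m1 \<in> path_trace q" "m2 \<in> path_trace q"
    using q(1-3) set_subset_path_trace unfolding polygonal_path_def by (metis hd_in_set last_in_set subsetD)+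
  then obtain g where g: "path g" "path_image g \<subseteq> path_trace q" "pathstart g = m1" "pathfinish g = m2"
    using path_connected_path_trace unfolding path_connected_def by metis
  define C where "C = linepath v m1 +++ g +++ linepath m2 v"
  define W where "W h = winding_number C (hex_center \<delta> h)" for h
  have jump: "W F \<noteq> W L"
    unfolding W_def C_def by (rule winding_number_jump[OF m(2,3,4) q(1,2,4) g(1,3,4,2) L(1,2)])
  have C: "path C" "pathfinish C = pathstart C" using g by (auto simp: C_def)
  have imC: "path_image C = closed_segment v m1 \<union> path_image g \<union> closed_segment m2 v"
    unfolding C_def using g by (auto simp: path_image_join)
  have qne: "q \<noteq> []" using q(1) by (simp add: polygonal_path_def)
  \<comment> \<open>The loop is placed on the trace of a lattice path, so that membership in a list
    decides which vertices it meets.\<close>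
  have "path_trace (v # q @ [v]) = closed_segment v m1 \<union> (path_trace q \<union> closed_segment m2 v)"
  proof -
    have "path_trace (q @ [v]) = path_trace q \<union> closed_segment m2 v"
    proof -
      obtain q' where "q = q' @ [m2]" using q(3) qne by (metis append_butlast_last_id)
      then show ?thesis using path_trace_append[of q' m2 "[v]"] by auto
    qed
    then show ?thesis using q(2) qne by (simp add: path_trace_Cons)
  qed
  then have imCr: "path_image C \<subseteq> path_trace (v # q @ [v])" using imC g(2) by blast
  have r: "polygonal_path \<delta> (v # q @ [v])" "lattice_pt (hd (v # q @ [v]))"
  proof -
    have "half_edge \<delta> v (hd q)" "half_edge \<delta> (last q) v" using q(2,3) m(2,3) by (simp_all add: half_edge_def)
    then show "polygonal_path \<delta> (v # q @ [v])"
      using q(1) qne by (simp add: polygonal_path_def successively_Cons successively_append_iff)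
    show "lattice_pt (hd (v # q @ [v]))" using endpoint_is_vertex[OF m(1)] by (simp add: lattice_pt_def)
  qed
  have const: "W h = W h'" if "w \<in> set vs" "h \<in> hexes_at w" "h' \<in> hexes_at w" for w h h'
  proof -
    have "w \<notin> path_trace (v # q @ [v])"
      using path_trace_lattice_pt[OF r] vs(2)[OF that(1)] by (auto simp: lattice_pt_def)
    then show ?thesis unfolding W_def
      using winding_number_around_pt[OF C imCr r _ that(2,3)] imCr by blast
  qed
  have chain: "W h = W L" if "h \<in> hexes_at w" "w \<in> set vs" for w h
  proof -
    \<comment> \<open>The induction removes vertices from the front, so every value is compared with
      one at the last vertex.\<close>
    have "W h = W h'" if "successively (\<lambda>x y. hexes_at x \<inter> hexes_at y \<noteq> {}) ws" "set ws \<subseteq> set vs"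
      "h \<in> hexes_at w" "w \<in> set ws" "h' \<in> hexes_at (last ws)" for ws h h' w
      using that
    proof (induction ws arbitrary: w h)
      case (Cons y ws)
      show ?case
      proof (cases "ws = []")
        case True
        then have "w = y" "h \<in> hexes_at y" "h' \<in> hexes_at y" "y \<in> set vs" using Cons.prems by simp_all
        then show ?thesis using const by blast
      next
        case False
        obtain k where k: "k \<in> hexes_at y" "k \<in> hexes_at (hd ws)" using Cons.prems(1) False by (auto simp: successively_Cons)
        have "W k = W h'" by (rule Cons.IH[of _ "hd ws"]) (use Cons.prems False k in \<open>auto simp: successively_Cons\<close>)
        show ?thesis
        proof (cases "w \<in> set ws")
          case True
          then show ?thesis using Cons.prems False by (intro Cons.IH) (auto simp: successively_Cons)
        next
          case w: False
          then have "h \<in> hexes_at y" "y \<in> set vs" using Cons.prems by simp_all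
          then have "W h = W k" using k(1) const by blast
          then show ?thesis using \<open>W k = W h'\<close> by simp
        qed
      qed
    qed simp
    then show ?thesis using that vs(3,4) L(3) by blast
  qed
  have out: "W h = 0" if "h \<notin> D" for h
    unfolding W_def
  proof (rule winding_number_outside[OF sc C _ that])
    have "m1 \<in> hex_region \<delta> D" "m2 \<in> hex_region \<delta> D"
      using \<open>m1 \<in> path_trace q\<close> \<open>m2 \<in> path_trace q\<close> q(5) by blast+
    then show "path_image C \<subseteq> hex_region \<delta> D"
      unfolding imC using half_edge_subset_region[OF m(2)] half_edge_subset_region[OF m(3)] g(2) q(5)
      by (auto simp: closed_segment_commute)
  qed
  obtain w h where wh: "w \<in> set vs" "h \<in> hexes_at w" "hex_class D F = hex_class D h" using mem by auto
  have "W h = W L" using chain wh by blast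
  moreover have "W F = W h" using wh(3) out[of F] out[of h] by (auto simp: hex_class_def split: if_splits)
  ultimately show False using jump by simp
qed

section \<open>Paths in the domain\<close>

lemma polygonal_path_join:
  assumes "polygonal_path \<delta> q" "polygonal_path \<delta> r" "last q = hd r"
  shows "polygonal_path \<delta> (q @ tl r)" "hd (q @ tl r) = hd q" "last (q @ tl r) = last r"
    "set (q @ tl r) = set q \<union> set r" "path_trace (q @ tl r) = path_trace q \<union> path_trace r"
proof -
  obtain q' y where q: "q = q' @ [y]" using assms(1) unfolding polygonal_path_def by (metis rev_exhaust)
  obtain r' where r: "r = y # r'" using assms(2,3) q unfolding polygonal_path_def by (cases r) auto
  show "polygonal_path \<delta> (q @ tl r)"
    using assms(1,2) unfolding polygonal_path_def q r by (auto simp: successively_append_iff successively_Cons)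
  show "hd (q @ tl r) = hd q" "last (q @ tl r) = last r" "set (q @ tl r) = set q \<union> set r"
    unfolding q r by (auto simp: hd_append)
  show "path_trace (q @ tl r) = path_trace q \<union> path_trace r"
    unfolding q r using path_trace_append[of q' y r'] by simp
qed

lemma polygonal_path_rev: "polygonal_path \<delta> (rev q) \<longleftrightarrow> polygonal_path \<delta> q"
  by (simp add: polygonal_path_def half_edge_sym)

lemma polygonal_path_alternates:
  assumes "polygonal_path \<delta> w" "hd w \<in> mid_edges \<delta>" "i < length w"
  shows "if even i then w ! i \<in> mid_edges \<delta> else is_vertex (w ! i)"
  using assms(3)
proof (induction i)
  case 0
  then show ?case using assms(1,2) by (simp add: hd_conv_nth polygonal_path_def)
next
  case (Suc i)
  then have "half_edge \<delta> (w ! i) (w ! Suc i)"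
    using assms(1) unfolding polygonal_path_def successively_conv_nth by simp
  then show ?case using Suc vertex_not_mid_edge by (elim half_edge_cases) (auto split: if_splits)
qed

lemma card_star:
  assumes "is_vertex v"
  shows "card {n. endpoint \<delta> n v} = 3"
proof -
  from vertex_star[OF assms] obtain e1 e2 e3 where s: "e1 \<noteq> e2" "e1 \<noteq> e3" "e2 \<noteq> e3" "\<And>n. endpoint \<delta> n v \<longleftrightarrow> n \<in> {e1, e2, e3}"
    by metis
  have "{n. endpoint \<delta> n v} = {e1, e2, e3}" using s(4) by auto
  then show ?thesis using s(1-3) by simp
qed

lemma other_endpoint_eq:
  assumes "endpoint \<delta> m u" "endpoint \<delta> m v" "u \<noteq> v"
  shows "other_endpoint \<delta> m u = v"
  unfolding other_endpoint_def using two_endpoints(2)[OF assms] assms by (intro the_equality) auto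

section \<open>The half-edge that joins the boundary mid-edge to the domain\<close>

text \<open>Points of the half-edge other than \<open>e\<close> lie in exactly the hexagons of
  \<open>a\<close>, so a lattice path through one of them would have \<open>a\<close> in its
  list.\<close>

lemma path_trace_avoiding_whisker:
  assumes a: "endpoint \<delta> a e" "e \<in> hex_region \<delta> D"
    and q: "successively (half_edge \<delta>) q" "\<And>x. x \<in> set q \<Longrightarrow> lattice_pt x" "a \<notin> set q"
      "path_trace q \<subseteq> hex_region \<delta> D \<union> closed_segment a e"
  shows "path_trace q \<subseteq> hex_region \<delta> D"
proof
  fix z assume z: "z \<in> path_trace q"
  show "z \<in> hex_region \<delta> D"
  proof (cases "z \<in> closed_segment a e \<and> z \<noteq> e")
    case True
    then have "hexes_at z = hexes_at a" using hexes_at_half_edge[OF a(1)] by blast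
    moreover obtain x where "x \<in> set q" "hexes_at z = hexes_at x" using path_trace_hexes[OF q(1) z] by blast
    moreover have "lattice_pt a" using endpoint_mid_edge[OF a(1)] by (simp add: lattice_pt_def)
    ultimately show ?thesis using lattice_pt_hexes_inj q(2,3) by metis
  qed (use q(4) z a(2) in blast)
qed

text \<open>A vertex lies in three hexagons, whereas the points of the half-edge other than
  \<open>e\<close> lie in two.\<close>

lemma endpoint_in_region_whisker:
  assumes "endpoint \<delta> a e" "\<And>x. endpoint \<delta> a x \<Longrightarrow> x \<in> hex_region \<delta> D \<Longrightarrow> x = e"
    "endpoint \<delta> a v" "v \<in> hex_region \<delta> D \<union> closed_segment a e"
  shows "v = e"
proof (rule ccontr)
  assume "v \<noteq> e"
  then have "v \<in> closed_segment a e" using assms by blast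
  then have "hexes_at v = hexes_at a" using hexes_at_half_edge[OF assms(1)] \<open>v \<noteq> e\<close> by blast
  then show False
    using card_hexes_vertex[OF endpoint_is_vertex[OF assms(3)]] card_hexes_mid_edge[OF endpoint_mid_edge[OF assms(1)]] by simp
qed

text \<open>The path is cut just before its first visit to \<open>a\<close>. The entry there is an
  endpoint of \<open>a\<close> within the permitted set, hence \<open>e\<close>, and nothing up to
  that point uses the rest of the half-edge.\<close>

lemma path_to_entry_vertex:
  assumes a: "endpoint \<delta> a e" "e \<in> hex_region \<delta> D" "\<And>x. endpoint \<delta> a x \<Longrightarrow> x \<in> hex_region \<delta> D \<Longrightarrow> x = e"
    and q: "polygonal_path \<delta> q" "lattice_pt (hd q)" "hd q \<noteq> a" "last q = a"
      "path_trace q \<subseteq> hex_region \<delta> D \<union> closed_segment a e"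
  shows "\<exists>q'. polygonal_path \<delta> q' \<and> hd q' = hd q \<and> last q' = e \<and> set q' \<subseteq> set q \<and> path_trace q' \<subseteq> hex_region \<delta> D"
proof -
  have "a \<in> set q" using q(1,4) by (auto simp: polygonal_path_def)
  then obtain ys zs where q': "q = ys @ a # zs" "a \<notin> set ys" by (metis split_list_first)
  have ne: "ys \<noteq> []" using q(3) q' by auto
  have s: "successively (half_edge \<delta>) ys" "half_edge \<delta> (last ys) a"
    using q(1) ne unfolding q' polygonal_path_def by (simp_all add: successively_append_iff)
  have am: "a \<in> mid_edges \<delta>" using endpoint_mid_edge[OF a(1)] .
  have "endpoint \<delta> a (last ys)" using s(2) vertex_not_mid_edge am by (auto elim: half_edge_cases)
  moreover have "last ys \<in> hex_region \<delta> D \<union> closed_segment a e"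
  proof -
    have "last ys \<in> set q" using ne q'(1) by simp
    then show ?thesis using q(5) set_subset_path_trace[of q] by blast
  qed
  ultimately have "last ys = e" using endpoint_in_region_whisker[OF a(1,3)] by blast
  moreover have "path_trace ys \<subseteq> hex_region \<delta> D"
  proof (rule path_trace_avoiding_whisker[OF a(1,2) s(1) _ q'(2)])
    show "lattice_pt x" if "x \<in> set ys" for x using polygonal_path_lattice[OF q(1,2)] that q' by auto
    have "path_trace ys \<subseteq> path_trace q"
    proof -
      obtain y ys' where "rev ys = y # ys'" using ne by (cases "rev ys") auto
      then have "path_trace ys = path_trace (y # ys')" by (metis path_trace_rev)
      also have "\<dots> \<subseteq> path_trace (rev zs @ a # y # ys')"
        using path_trace_append[of "rev zs" a "y # ys'"] by auto
      also have "rev zs @ a # y # ys' = rev q" using \<open>rev ys = y # ys'\<close> by (simp add: q')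
      finally show ?thesis by (simp add: path_trace_rev)
    qed
    then show "path_trace ys \<subseteq> hex_region \<delta> D \<union> closed_segment a e" using q(5) by blast
  qed
  moreover have "hd ys = hd q" using ne q' by simp
  ultimately show ?thesis using s(1) ne q' by (intro exI[of _ ys]) (auto simp: polygonal_path_def)
qed

lemma common_endpoint_eq:
  assumes "endpoint \<delta> m v" "endpoint \<delta> n v" "m \<noteq> n"
  shows "common_endpoint \<delta> m n = v"
  unfolding common_endpoint_def
proof (rule the_equality)
  fix x assume x: "endpoint \<delta> m x \<and> endpoint \<delta> n x"
  show "x = v"
  proof (rule ccontr)
    assume ne: "x \<noteq> v"
    then show False using two_endpoints(1)[of m x v] two_endpoints(1)[of n x v] x assms by simp
  qed
qed (use assms in blast)

text \<open>The stars of the two ends have three edges each and share only \<open>b\<close>, which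
  gives \<open>3 + 3 - 1\<close> edges and four without \<open>b\<close>.\<close>

lemma card_neighbours:
  assumes "b \<in> mid_edges \<delta>"
  shows "card {m \<in> mid_edges \<delta>. m \<noteq> b \<and> dist m b \<le> \<delta>} = 4"
proof -
  obtain u v where uv: "up_vertex u" "\<not> up_vertex v" "hexes_at u \<inter> hexes_at v = hexes_at b" "b = midpoint u v" "{y. endpoint \<delta> b y} = {u, v}"
    using mid_edge_endpoints[OF assms] by blast
  have ne: "u \<noteq> v" using uv by auto
  have e: "endpoint \<delta> b u" "endpoint \<delta> b v" using uv(5) by auto
  let ?U = "{n. endpoint \<delta> n u}" and ?V = "{n. endpoint \<delta> n v}"
  have iff: "endpoint \<delta> b y \<longleftrightarrow> y = u \<or> y = v" for y using uv(5) by auto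
  have "{m \<in> mid_edges \<delta>. m \<noteq> b \<and> dist m b \<le> \<delta>} = (?U \<union> ?V) - {b}"
    using dist_mid_edges_iff[OF _ assms] endpoint_mid_edge unfolding iff by auto
  moreover have "?U \<inter> ?V = {b}"
  proof -
    have "n = b" if "endpoint \<delta> n u" "endpoint \<delta> n v" for n
      using common_endpoint_eq[OF that(1) e(1)] common_endpoint_eq[OF that(2) e(2)] ne by metis
    then show ?thesis using e by blast
  qed
  moreover have c: "card ?U = 3" "card ?V = 3"
    using card_star endpoint_is_vertex e by blast+
  moreover have "finite ?U" "finite ?V" using c by (auto intro: card_ge_0_finite)
  ultimately show ?thesis using card_Un_Int[of ?U ?V] e by simp
qed

end

section \<open>The law of the exploration along a given path\<close>

text \<open>The two directions of the exploration differ only in the verification of \<open>walk_in\<close> and \<open>connect\<close>.\<close>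

locale hex_walk = hex_lattice +
  fixes D :: "(int \<times> int) set" and R :: "complex set" and t :: complex and w :: "complex list"
  assumes simply_conn: "simply_connected (hex_region \<delta> D)"
    and region_subset: "hex_region \<delta> D \<subseteq> R"
    and walk: "polygonal_path \<delta> w" "distinct w" "hd w \<in> mid_edges \<delta>" "last w = t" "t \<in> mid_edges \<delta>"
    and walk_in: "\<And>n. 2 \<le> n \<Longrightarrow> n < length w \<Longrightarrow> path_trace (drop n w) \<subseteq> R"
    and connect: "\<And>v m1 m2 q1 q2. endpoint \<delta> m1 v \<Longrightarrow> endpoint \<delta> m2 v \<Longrightarrow> m1 \<noteq> m2 \<Longrightarrow> v \<in> set w \<Longrightarrow>
      polygonal_path \<delta> q1 \<Longrightarrow> hd q1 = m1 \<Longrightarrow> last q1 = t \<Longrightarrow> path_trace q1 \<subseteq> R \<Longrightarrow> v \<notin> set q1 \<Longrightarrow>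
      polygonal_path \<delta> q2 \<Longrightarrow> hd q2 = m2 \<Longrightarrow> last q2 = t \<Longrightarrow> path_trace q2 \<subseteq> R \<Longrightarrow> v \<notin> set q2 \<Longrightarrow>
      \<exists>q. polygonal_path \<delta> q \<and> hd q = m1 \<and> last q = m2 \<and> set q \<subseteq> set q1 \<union> set q2 \<and> path_trace q \<subseteq> hex_region \<delta> D"
begin

section \<open>The given path indexed by its steps\<close>

definition mid :: "nat \<Rightarrow> complex" where "mid k = w ! (2 * k)"
definition vert :: "nat \<Rightarrow> complex" where "vert k = w ! (2 * k + 1)"
definition steps :: nat where "steps = length w div 2"
text \<open>For \<open>k >= 1\<close> this includes the hexagons at \<open>mid 0\<close> up to
  \<open>mid k\<close>, since each of these has one of the first \<open>k\<close> vertices as an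
  endpoint.\<close>

definition seen :: "nat \<Rightarrow> (int \<times> int) set" where "seen k = (\<Union>i<k. hexes_at (vert i))"

lemma length_walk: "length w = 2 * steps + 1"
proof -
  have ne: "w \<noteq> []" using walk(1) by (simp add: polygonal_path_def)
  have "even (length w - 1)"
  proof (rule ccontr)
    assume "odd (length w - 1)"
    then have "is_vertex (w ! (length w - 1))"
      using polygonal_path_alternates[OF walk(1,3), of "length w - 1"] ne by simp
    then show False using vertex_not_mid_edge walk(4,5) ne by (metis last_conv_nth)
  qed
  then have "odd (length w)" using ne by (cases "length w") auto
  then show ?thesis by (simp add: steps_def)
qed

lemma mid_mid: "k \<le> steps \<Longrightarrow> mid k \<in> mid_edges \<delta>"
  using polygonal_path_alternates[OF walk(1,3), of "2 * k"] length_walk by (simp add: mid_def)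

lemma vert_vertex: "k < steps \<Longrightarrow> is_vertex (vert k)"
  using polygonal_path_alternates[OF walk(1,3), of "2 * k + 1"] length_walk by (simp add: vert_def)

lemma endpoint_mid_vert: "k < steps \<Longrightarrow> endpoint \<delta> (mid k) (vert k)" "k < steps \<Longrightarrow> endpoint \<delta> (mid (Suc k)) (vert k)"
proof -
  assume k: "k < steps"
  have "half_edge \<delta> (mid k) (vert k)" "half_edge \<delta> (vert k) (mid (Suc k))"
    using walk(1) k length_walk unfolding polygonal_path_def successively_conv_nth mid_def vert_def
    by (auto dest: spec[of _ "2 * k"] spec[of _ "2 * k + 1"])
  then show "endpoint \<delta> (mid k) (vert k)" "endpoint \<delta> (mid (Suc k)) (vert k)"
    using vertex_not_mid_edge[OF vert_vertex[OF k]] by (auto elim: half_edge_cases)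
qed

lemma mid_inj: "i \<le> steps \<Longrightarrow> j \<le> steps \<Longrightarrow> mid i = mid j \<longleftrightarrow> i = j"
  using walk(2) length_walk by (simp add: mid_def nth_eq_iff_index_eq)

lemma vert_inj: "i < steps \<Longrightarrow> j < steps \<Longrightarrow> vert i = vert j \<longleftrightarrow> i = j"
  using walk(2) length_walk by (simp add: vert_def nth_eq_iff_index_eq)

lemma take_Suc: "k < steps \<Longrightarrow> take (2 * Suc k + 1) w = take (2 * k + 1) w @ [vert k, mid (Suc k)]"
  using length_walk by (simp add: vert_def mid_def take_Suc_conv_app_nth)

lemma last_take: "k \<le> steps \<Longrightarrow> last (take (2 * k + 1) w) = mid k"
  using length_walk by (simp add: mid_def take_Suc_conv_app_nth)

lemma set_take: "x \<in> set (take (2 * k + 1) w) \<Longrightarrow> k \<le> steps \<Longrightarrow> (\<exists>i\<le>k. x = mid i) \<or> (\<exists>i<k. x = vert i)"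
proof -
  assume "x \<in> set (take (2 * k + 1) w)" "k \<le> steps"
  then obtain j where j: "j < 2 * k + 1" "x = w ! j" by (auto simp: in_set_conv_nth)
  then show ?thesis
  proof (cases "even j")
    case True
    then obtain i where "j = 2 * i" by blast
    then have "i \<le> k" "x = mid i" using j by (simp_all add: mid_def)
    then show ?thesis by blast
  next
    case False
    then obtain i where "j = 2 * i + 1" by (metis oddE)
    then have "i < k" "x = vert i" using j by (simp_all add: vert_def)
    then show ?thesis by blast
  qed
qed

lemma vert_in_take: "i < k \<Longrightarrow> k \<le> steps \<Longrightarrow> vert i \<in> set (take (2 * k + 1) w)"
  using length_walk by (auto simp: vert_def in_set_conv_nth intro!: exI[of _ "2 * i + 1"])

lemma hd_walk: "hd w = mid 0"
  using walk(1) by (simp add: mid_def hd_conv_nth polygonal_path_def)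

lemma last_walk: "t = mid steps"
  using walk(1,4) length_walk by (simp add: mid_def last_conv_nth polygonal_path_def)

section \<open>Counting the allowable moves along the path\<close>

lemma allowable_iff:
  assumes "k < steps"
  shows "n \<in> allowable \<delta> R t (take (2 * k + 1) w) (vert k) \<longleftrightarrow>
    endpoint \<delta> n (vert k) \<and> n \<noteq> mid k \<and>
    (\<exists>q. polygonal_path \<delta> q \<and> hd q = n \<and> last q = t \<and> path_trace q \<subseteq> R \<and>
      set q \<inter> set (take (2 * k + 1) w @ [vert k]) = {})"
proof -
  let ?p = "take (2 * k + 1) w @ [vert k]"
  have p: "?p = take (2 * k + 2) w" using assms length_walk by (simp add: vert_def take_Suc_conv_app_nth)
  have "polygonal_path \<delta> ?p"
  proof -
    have "successively (half_edge \<delta>) (take (2 * k + 2) w)"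
      using walk(1) successively_take_drop(1) unfolding polygonal_path_def by blast
    then show ?thesis unfolding polygonal_path_def p[symmetric] by simp
  qed
  moreover have "hd ?p = mid 0" using p hd_walk walk(1) by (simp add: polygonal_path_def)
  then have "lattice_pt (hd ?p)" using mid_mid[of 0] by (simp add: lattice_pt_def)
  ultimately have 1: "path_trace q \<inter> path_trace ?p = {} \<longleftrightarrow> set q \<inter> set ?p = {}"
    if "polygonal_path \<delta> q" "lattice_pt (hd q)" for q
    using path_trace_disjoint that by blast
  have 2: "lattice_pt n" if "endpoint \<delta> n (vert k)"
    using endpoint_mid_edge[OF that] by (simp add: lattice_pt_def)
  have 3: "polygonal_path \<delta> q \<and> hd q = n \<and> last q = t \<and> path_trace q \<subseteq> R \<and> path_trace q \<inter> path_trace ?p = {} \<longleftrightarrow>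
      polygonal_path \<delta> q \<and> hd q = n \<and> last q = t \<and> path_trace q \<subseteq> R \<and> set q \<inter> set ?p = {}"
    if "endpoint \<delta> n (vert k)" for q
    using 1[of q] 2[OF that] by blast
  have "last (take (2 * k + 1) w) = mid k" using last_take assms by simp
  then show ?thesis
    unfolding allowable_def mem_Collect_eq using 3 by (cases "endpoint \<delta> n (vert k)") simp_all
qed

text \<open>The rest of \<open>w\<close> is itself a connection to \<open>t\<close>, and it avoids
  the past because \<open>w\<close> is simple.\<close>

lemma next_allowable:
  assumes "k < steps" "1 \<le> k"
  shows "mid (Suc k) \<in> allowable \<delta> R t (take (2 * k + 1) w) (vert k)"
proof -
  let ?q = "drop (2 * k + 2) w"
  have "set ?q \<inter> set (take (2 * k + 2) w) = {}"
    using set_take_disj_set_drop_if_distinct[OF walk(2), of "2 * k + 2" "2 * k + 2"] by auto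
  moreover have "take (2 * k + 1) w @ [vert k] = take (2 * k + 2) w" using assms length_walk by (simp add: vert_def take_Suc_conv_app_nth)
  moreover have "hd ?q = mid (Suc k)" using assms length_walk by (simp add: mid_def hd_drop_conv_nth)
  moreover have "last ?q = t" using assms length_walk walk(4) by (simp add: last_drop)
  moreover have "polygonal_path \<delta> ?q"
  proof -
    have "successively (half_edge \<delta>) ?q"
      using walk(1) successively_take_drop(2) unfolding polygonal_path_def by blast
    then show ?thesis using assms length_walk unfolding polygonal_path_def by simp
  qed
  moreover have "path_trace ?q \<subseteq> R" using walk_in[of "2 * k + 2"] assms length_walk by simp
  ultimately show ?thesis
    using allowable_iff[OF assms(1)] endpoint_mid_vert(2)[OF assms(1)] mid_inj[of "Suc k" k] assms(1) by auto
qed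

text \<open>The powers of 2 unite both cases of the dichotomy: the exponent grows by one exactly
  when two moves are allowable. The hexagons at \<open>mid k\<close> were seen at the previous
  vertex, so \<open>F\<close> alone can bring a new class.\<close>

lemma allowable_card:
  assumes k: "k < steps" "1 \<le> k"
  defines "A \<equiv> allowable \<delta> R t (take (2 * k + 1) w) (vert k)"
  shows "finite A" "card A * 2 ^ card (hex_class D ` seen k) = 2 ^ card (hex_class D ` seen (Suc k))"
proof -
  let ?m = "mid k" and ?v = "vert k" and ?m1 = "mid (Suc k)"
  have fin: "finite (seen k)" unfolding seen_def
    using k by (intro finite_UN_I) (auto intro!: card_ge_0_finite simp: card_hexes_vertex[OF vert_vertex])
  have m: "endpoint \<delta> ?m ?v" "endpoint \<delta> ?m1 ?v" "?m \<noteq> ?m1"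
    using endpoint_mid_vert k mid_inj[of k "Suc k"] by auto
  obtain m2 F where m2: "endpoint \<delta> m2 ?v" "m2 \<noteq> ?m" "m2 \<noteq> ?m1" "{n. endpoint \<delta> n ?v} = {?m, ?m1, m2}"
    and F: "F \<in> hexes_at ?v - hexes_at ?m" "hexes_at ?v = insert F (hexes_at ?m)"
  proof -
    have c: "card {n. endpoint \<delta> n ?v} = 3" by (rule card_star[OF vert_vertex[OF k(1)]])
    have "{?m, ?m1} \<subseteq> {n. endpoint \<delta> n ?v}" using m by simp
    then have "card ({n. endpoint \<delta> n ?v} - {?m, ?m1}) = 1" using c m(3) by (subst card_Diff_subset) auto
    then obtain m2 where "{n. endpoint \<delta> n ?v} - {?m, ?m1} = {m2}" by (rule card_1_singletonE)
    then have m2: "endpoint \<delta> m2 ?v" "m2 \<noteq> ?m" "m2 \<noteq> ?m1" "{n. endpoint \<delta> n ?v} = {?m, ?m1, m2}" using m by auto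
    obtain F where F: "F \<notin> hexes_at ?m" "hexes_at ?v = insert F (hexes_at ?m)" by (rule hexagon_ahead[OF m(1)])
    show thesis by (rule that[OF m2, of F]) (use F in auto)
  qed
  have u: "endpoint \<delta> ?m (vert (k - 1))" using endpoint_mid_vert(2)[of "k - 1"] k by simp
  have mU: "hexes_at ?m \<subseteq> seen k" unfolding seen_def using endpoint_hexes[OF u] k by force
  have seen_Suc: "hex_class D ` seen (Suc k) = insert (hex_class D F) (hex_class D ` seen k)"
  proof -
    have "seen (Suc k) = insert F (seen k)" using mU F(2) by (auto simp: seen_def lessThan_Suc)
    then show ?thesis by simp
  qed
  have m1A: "?m1 \<in> A" unfolding A_def by (rule next_allowable[OF k])
  have sub: "A \<subseteq> {?m1, m2}" using m2(4) allowable_iff[OF k(1)] unfolding A_def by auto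
  then show finA: "finite A" using finite_subset by blast
  have new: "m2 \<in> A \<longleftrightarrow> hex_class D F \<notin> hex_class D ` seen k"
  proof
    assume nw: "hex_class D F \<notin> hex_class D ` seen k"
    obtain L1 where L1: "hexes_at ?m1 = {F, L1}" "F \<noteq> L1" "L1 \<in> hexes_at ?m" by (rule mid_edge_ahead[OF m F(1)])
    obtain L2 where L2: "hexes_at m2 = {F, L2}" "F \<noteq> L2" "L2 \<in> hexes_at ?m"
      by (rule mid_edge_ahead[OF m(1) m2(1) m2(2)[symmetric] F(1)])
    \<comment> \<open>If \<open>F\<close> is outside and its class is new, everything seen so far
      belongs to \<open>D\<close>. The finite set \<open>seen k\<close> then has \<open>?m1\<close>
      and \<open>m2\<close> on its boundary, just as \<open>{F}\<close> does in the other
      case.\<close>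
    define Q where "Q = (if F \<in> D then {F} else seen k)"
    have FU: "F \<notin> seen k" using nw by blast
    have UD: "F \<notin> D \<Longrightarrow> seen k \<subseteq> D" using nw by (force simp: hex_class_def)
    have QD: "Q \<subseteq> D" using UD by (auto simp: Q_def)
    have st: "straddles Q ?m1" "straddles Q m2"
      using L1 L2 FU mU by (auto simp: straddles_def Q_def)
    \<comment> \<open>The hexagons at an earlier vertex all belong to \<open>Q\<close> if
      \<open>Q\<close> is \<open>seen k\<close>, and none does if \<open>Q\<close> is
      \<open>{F}\<close>. So a path of straddling points avoids the past.\<close>
    have vs: "\<not> straddles Q (vert i)" if "i < k" for i
    proof -
      have "hexes_at (vert i) \<subseteq> seen k" using that by (auto simp: seen_def)
      then show ?thesis using FU by (auto simp: straddles_def Q_def)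
    qed
    obtain q where q: "polygonal_path \<delta> q" "hd q = m2" "last q = ?m1" "?v \<notin> set q" "\<forall>x\<in>set q. straddles Q x"
      by (rule straddling_path[OF _ m2(1) st(2) m(2) st(1) m2(3)]) (use fin in \<open>auto simp: Q_def\<close>)
    have qR: "path_trace q \<subseteq> R"
    proof -
      have "path_trace q \<subseteq> hex_region \<delta> D"
        using q(1,5) QD by (intro path_trace_subset_region) (auto simp: polygonal_path_def mem_hex_region straddles_def)
      then show ?thesis using region_subset by blast
    qed
    have qd: "set q \<inter> set (take (2 * k + 1) w @ [?v]) = {}"
    proof -
      have "\<not> straddles Q x" if "x \<in> set (take (2 * k + 1) w)" for x
      proof -
        have "k \<le> steps" using k by simp
        from set_take[OF that this] show ?thesis
        proof (elim disjE exE conjE)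
          fix i assume "i \<le> k" "x = mid i"
          moreover have "\<exists>j<k. endpoint \<delta> (mid i) (vert j)"
          proof (intro exI[of _ "i - 1"] conjI)
            show "i - 1 < k" using \<open>i \<le> k\<close> k by linarith
            show "endpoint \<delta> (mid i) (vert (i - 1))"
              using endpoint_mid_vert(1)[of 0] endpoint_mid_vert(2)[of "i - 1"] \<open>i \<le> k\<close> k by (cases i) auto
          qed
          ultimately show ?thesis using vs straddles_endpoint by blast
        qed (use vs in blast)
      qed
      then show ?thesis using q(4,5) by auto
    qed
    \<comment> \<open>The connection for \<open>m2\<close> goes round to \<open>?m1\<close> and
      continues from there to \<open>t\<close>.\<close>
    obtain r where r: "polygonal_path \<delta> r" "hd r = ?m1" "last r = t" "path_trace r \<subseteq> R" "set r \<inter> set (take (2 * k + 1) w @ [?v]) = {}"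
      using m1A allowable_iff[OF k(1)] unfolding A_def by blast
    note j = polygonal_path_join[OF q(1) r(1)]
    have "last q = hd r" using q(3) r(2) by simp
    note j = j[OF this]
    have "polygonal_path \<delta> (q @ tl r) \<and> hd (q @ tl r) = m2 \<and> last (q @ tl r) = t \<and> path_trace (q @ tl r) \<subseteq> R \<and>
      set (q @ tl r) \<inter> set (take (2 * k + 1) w @ [?v]) = {}"
      unfolding j(2-5) using j(1) q(2) r(3,4) qR qd r(5) by blast
    then show "m2 \<in> A" unfolding A_def allowable_iff[OF k(1)] using m2 by blast
  next
    assume "m2 \<in> A"
    then obtain q2 where q2: "polygonal_path \<delta> q2" "hd q2 = m2" "last q2 = t" "path_trace q2 \<subseteq> R" "set q2 \<inter> set (take (2 * k + 1) w @ [?v]) = {}"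
      using allowable_iff[OF k(1)] unfolding A_def by blast
    obtain q1 where q1: "polygonal_path \<delta> q1" "hd q1 = ?m1" "last q1 = t" "path_trace q1 \<subseteq> R" "set q1 \<inter> set (take (2 * k + 1) w @ [?v]) = {}"
      using m1A allowable_iff[OF k(1)] unfolding A_def by blast
    have vw: "?v \<in> set w" using k length_walk by (simp add: vert_def)
    have vn: "?v \<notin> set q1" "?v \<notin> set q2" using q1(5) q2(5) by auto
    \<comment> \<open>The two connections to \<open>t\<close> are traded for one path between the
      two moves, which closes up at \<open>?v\<close>.\<close>
    obtain q where q: "polygonal_path \<delta> q" "hd q = ?m1" "last q = m2" "set q \<subseteq> set q1 \<union> set q2" "path_trace q \<subseteq> hex_region \<delta> D"
      using connect[OF m(2) m2(1) m2(3)[symmetric] vw q1(1-4) vn(1) q2(1-4) vn(2)] by blast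
    define vs where "vs = map vert [0..<k]"
    have "hex_class D F \<notin> hex_class D ` (\<Union>w\<in>set vs. hexes_at w)"
    proof (rule visited_hexagon_separates[OF simply_conn m(1,2) m2(1) m2(3)[symmetric] m(3) m2(2)[symmetric] q(1-3) _ q(5) _ _ _ _ F(1)])
      show "?v \<notin> set q" using q(4) vn by blast
      show "vs \<noteq> []" using k by (simp add: vs_def)
      show "is_vertex x \<and> x \<noteq> ?v \<and> x \<notin> set q" if x: "x \<in> set vs" for x
      proof -
        obtain i where i: "i < k" "x = vert i" using x by (auto simp: vs_def)
        then have "x \<in> set (take (2 * k + 1) w)" using vert_in_take k by simp
        then have "x \<notin> set q" using q(4) q1(5) q2(5) by auto
        then show ?thesis using i k vert_vertex vert_inj[of i k] by auto
      qed
      show "successively (\<lambda>x y. hexes_at x \<inter> hexes_at y \<noteq> {}) vs"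
        unfolding successively_conv_nth
      proof (intro allI impI)
        fix i assume "Suc i < length vs"
        then have i: "Suc i < k" by (simp add: vs_def)
        have "hexes_at (mid (Suc i)) \<noteq> {}" using card_hexes_mid_edge[OF mid_mid[of "Suc i"]] i k by auto
        moreover have "hexes_at (mid (Suc i)) \<subseteq> hexes_at (vert i)" "hexes_at (mid (Suc i)) \<subseteq> hexes_at (vert (Suc i))"
          using endpoint_hexes endpoint_mid_vert i k by auto
        ultimately show "hexes_at (vs ! i) \<inter> hexes_at (vs ! Suc i) \<noteq> {}" using i by (auto simp: vs_def)
      qed
      have "last vs = vert (k - 1)" using k by (simp add: vs_def last_map)
      then show "hexes_at ?m \<subseteq> hexes_at (last vs)" using endpoint_hexes[OF u] by simp
    qed
    moreover have "(\<Union>w\<in>set vs. hexes_at w) = seen k" by (auto simp: vs_def seen_def)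
    ultimately show "hex_class D F \<notin> hex_class D ` seen k" by simp
  qed
  show "card A * 2 ^ card (hex_class D ` seen k) = 2 ^ card (hex_class D ` seen (Suc k))"
  proof (cases "m2 \<in> A")
    case True
    then have "A = {?m1, m2}" using sub m1A by blast
    then have "card A = 2" using m2(3) by simp
    moreover have "card (hex_class D ` seen (Suc k)) = Suc (card (hex_class D ` seen k))"
      unfolding seen_Suc using True new fin by simp
    ultimately show ?thesis by simp
  next
    case False
    then have "A = {?m1}" using sub m1A by blast
    moreover have "hex_class D ` seen (Suc k) = hex_class D ` seen k"
      unfolding seen_Suc using False new by auto
    ultimately show ?thesis by simp
  qed
qed

text \<open>\<open>allowable_card\<close> telescopes backwards from the completed path, where the
  law is a point mass. The range starts at 1 because the first move follows a rule of its
  own.\<close>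

lemma spmf_explore:
  assumes "1 \<le> k" "k \<le> steps"
  shows "spmf (explore \<delta> R t (take (2 * k + 1) w)) w * 2 ^ card (hex_class D ` seen steps) = 2 ^ card (hex_class D ` seen k)"
  using assms(2,1)
proof (induction k rule: inc_induct)
  case base
  have "take (2 * steps + 1) w = w" using length_walk by simp
  moreover have "explore \<delta> R t w = return_spmf w" using walk(4) by (subst explore.simps) simp
  ultimately show ?case by simp
next
  case (step k)
  let ?p = "take (2 * k + 1) w"
  have last: "last ?p = mid k" using last_take step by simp
  have ne: "last ?p \<noteq> t" using last last_walk mid_inj[of k steps] step by simp
  have "last (butlast ?p) = vert (k - 1)"
  proof -
    have "?p = take (2 * (k - 1) + 1) w @ [vert (k - 1), mid k]" using take_Suc[of "k - 1"] step by simp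
    then show ?thesis by (simp add: butlast_append)
  qed
  moreover have "other_endpoint \<delta> (mid k) (vert (k - 1)) = vert k"
  proof (rule other_endpoint_eq)
    show "endpoint \<delta> (mid k) (vert (k - 1))" using endpoint_mid_vert(2)[of "k - 1"] step by simp
    show "endpoint \<delta> (mid k) (vert k)" using endpoint_mid_vert(1) step by simp
    show "vert (k - 1) \<noteq> vert k" using vert_inj[of "k - 1" k] step by simp
  qed
  ultimately have oe: "other_endpoint \<delta> (last ?p) (last (butlast ?p)) = vert k" using last by simp
  have w: "w = ?p @ [vert k, mid (Suc k)] @ drop (2 * Suc k + 1) w"
    using take_Suc[of k] step append_take_drop_id[of "2 * Suc k + 1" w] by simp
  let ?A = "allowable \<delta> R t ?p (vert k)"
  let ?c = "\<lambda>k. 2 ^ card (hex_class D ` seen k) :: real"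
  have A: "finite ?A" "card ?A * 2 ^ card (hex_class D ` seen k) = 2 ^ card (hex_class D ` seen (Suc k))"
    using allowable_card step by simp_all
  have e: "real (card ?A) * spmf (explore \<delta> R t ?p) w = spmf (explore \<delta> R t (take (2 * Suc k + 1) w)) w"
    using spmf_explore_step[OF ne oe A(1) next_allowable w] take_Suc[of k] step by simp
  have c: "real (card ?A) * ?c k = ?c (Suc k)"
    using arg_cong[OF A(2), of real] by simp
  have IH: "spmf (explore \<delta> R t (take (2 * Suc k + 1) w)) w * ?c steps = ?c (Suc k)"
    using step by simp
  have "real (card ?A) \<noteq> 0" using c by (metis mult_zero_left power_not_zero zero_neq_numeral)
  moreover have "real (card ?A) * (spmf (explore \<delta> R t ?p) w * ?c steps) = real (card ?A) * ?c k"
    by (simp only: mult.assoc[symmetric] e IH c)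
  ultimately show ?case by (simp only: mult_cancel_left) simp
qed

section \<open>Seen hexagons and touched hexagons\<close>

text \<open>This description ignores the order of the path, so a path and its reversal see the same
  hexagons.\<close>

lemma seen_steps: "seen steps = (\<Union>x\<in>{x \<in> set w. is_vertex x}. hexes_at x)"
proof -
  have "{x \<in> set w. is_vertex x} = vert ` {..<steps}"
  proof (intro equalityI subsetI)
    fix x assume x: "x \<in> {x \<in> set w. is_vertex x}"
    then have "x \<in> set (take (2 * steps + 1) w)" using length_walk by simp
    then show "x \<in> vert ` {..<steps}" using set_take[of x steps] mid_mid vertex_not_mid_edge x by auto
  next
    fix x assume "x \<in> vert ` {..<steps}"
    then show "x \<in> {x \<in> set w. is_vertex x}" using vert_vertex length_walk by (auto simp: vert_def)
  qed
  then show ?thesis by (auto simp: seen_def)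
qed

text \<open>Every half-edge contains a vertex. Conversely, a hexagon borders two of the three edges
  at each of its vertices, and the path uses two of them as well, so one is in common.\<close>

lemma touched_hexagons_eq: "touched_hexagons \<delta> D w = D \<inter> seen steps"
proof (intro equalityI subsetI)
  fix h assume "h \<in> touched_hexagons \<delta> D w"
  then obtain x y where h: "h \<in> D" "half_edge \<delta> x y" "closed_segment x y \<subseteq> hexagon \<delta> h \<inter> path_trace w"
    unfolding touched_hexagons_def by blast
  have hd: "lattice_pt (hd w)" using walk(3) by (simp add: lattice_pt_def)
  have "\<exists>v\<in>{x, y}. is_vertex v" using h(2) by (auto elim: half_edge_cases)
  then obtain v where v: "is_vertex v" "v \<in> closed_segment x y" by auto
  then have "v \<in> set w" "h \<in> hexes_at v"
    using h(3) path_trace_lattice_pt[OF walk(1) hd] by (auto simp: lattice_pt_def mem_hexes_at)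
  then show "h \<in> D \<inter> seen steps" using h(1) v(1) unfolding seen_steps by auto
next
  fix h assume "h \<in> D \<inter> seen steps"
  then obtain i where i: "i < steps" "h \<in> hexes_at (vert i)" "h \<in> D" by (auto simp: seen_def)
  have e: "endpoint \<delta> (mid i) (vert i)" "endpoint \<delta> (mid (Suc i)) (vert i)" "mid i \<noteq> mid (Suc i)"
    using endpoint_mid_vert i mid_inj[of i "Suc i"] by auto
  have "\<exists>m\<in>{mid i, mid (Suc i)}. h \<in> hexes_at m"
  proof (cases "h \<in> hexes_at (mid i)")
    case False
    obtain L where "hexes_at (mid (Suc i)) = {h, L}" "h \<noteq> L" "L \<in> hexes_at (mid i)"
      by (rule mid_edge_ahead[OF e]) (use i(2) False in auto)
    then show ?thesis by auto
  qed simp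
  then obtain m where m: "m \<in> {mid i, mid (Suc i)}" "h \<in> hexes_at m" by blast
  have "closed_segment m (vert i) \<subseteq> hexagon \<delta> h"
    using closed_segment_subset[OF _ _ convex_hexagon] m(2) i(2) mem_hexes_at by blast
  moreover have "closed_segment m (vert i) \<subseteq> path_trace w"
    using m(1) closed_segment_subset_path_trace[of "2 * i" w] closed_segment_subset_path_trace[of "2 * i + 1" w] i(1) length_walk
    by (auto simp: mid_def vert_def closed_segment_commute)
  moreover have "half_edge \<delta> m (vert i)" using m(1) e by (auto simp: half_edge_def)
  ultimately show "h \<in> touched_hexagons \<delta> D w" using i(3) unfolding touched_hexagons_def by blast
qed

lemma finite_seen: "k \<le> steps \<Longrightarrow> finite (seen k)"
  unfolding seen_def by (intro finite_UN_I) (auto intro!: card_ge_0_finite simp: card_hexes_vertex[OF vert_vertex])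

text \<open>All seen hexagons outside the domain share the class \<open>None\<close>, which adds
  one.\<close>

lemma card_hex_class_seen:
  assumes "h \<in> seen steps" "h \<notin> D"
  shows "card (hex_class D ` seen steps) = Suc (card (D \<inter> seen steps))"
proof -
  have "hex_class D ` seen steps = insert None (Some ` (D \<inter> seen steps))"
    using assms by (force simp: hex_class_def)
  moreover have "finite (D \<inter> seen steps)" using finite_seen by simp
  ultimately show ?thesis by (simp add: card_image)
qed

lemma seen_1: "seen 1 = hexes_at (vert 0)"
  by (simp add: seen_def lessThan_Suc)

lemma walk_start: "1 \<le> steps \<Longrightarrow> w = [mid 0, vert 0, mid 1] @ drop 3 w"
  using take_Suc[of 0] length_walk append_take_drop_id[of 3 w] walk(1) 
  by (simp add: mid_def take_Suc_conv_app_nth numeral_3_eq_3)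

text \<open>The factor 2 on the left accounts for the class \<open>None\<close>, seen by the end of
  the path but not counted in \<open>D\<close>.\<close>

lemma spmf_from_start:
  assumes "1 \<le> steps" "h \<in> seen steps" "h \<notin> D"
  shows "spmf (explore \<delta> R t [mid 0, vert 0, mid 1]) w * 2 * 2 ^ card (D \<inter> seen steps) = 2 ^ card (hex_class D ` hexes_at (vert 0))"
proof -
  have "take 3 w = [mid 0, vert 0, mid 1]"
    using walk_start[OF assms(1)] by (metis append_eq_conv_conj length_Cons list.size(3) numeral_3_eq_3)
  then show ?thesis using spmf_explore[of 1] assms card_hex_class_seen[OF assms(2,3)] seen_1 by (simp add: mult.assoc)
qed

end

section \<open>Both directions\<close>

theorem lemma2:
  fixes \<delta> :: real and D :: "(int \<times> int) set" and a b :: complex and \<omega> :: "complex list"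
  assumes "\<delta> > 0"
    and "simply_connected (hex_region \<delta> D)"
    and "a \<in> mid_edges \<delta>" and "a \<notin> hex_region \<delta> D"
    and "\<exists>z \<in> frontier (hex_region \<delta> D). dist a z \<le> \<delta> / 2"
    and "\<exists>!v. endpoint \<delta> a v \<and> v \<in> hex_region \<delta> D"
    and "b \<in> mid_edges \<delta>" and "b \<in> hex_region \<delta> D"
    and "\<And>h. \<exists>z \<in> hexagon \<delta> h. dist b z \<le> \<delta> \<Longrightarrow> h \<in> D"
    and "simple_polygonal_path \<delta> \<omega>" and "hd \<omega> = a" and "last \<omega> = b"
    and "path_trace \<omega> \<subseteq> hex_region \<delta> D \<union> entry_half_edge \<delta> D a"
  shows "spmf (radial_exploration \<delta> D a b) \<omega> = (1 / 2) ^ card (touched_hexagons \<delta> D \<omega>) \<and>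
         spmf (reverse_radial_exploration \<delta> D a b) (rev \<omega>) = (1 / 2) ^ card (touched_hexagons \<delta> D \<omega>)"
proof -
  interpret hex_lattice \<delta> using assms(1) by unfold_locales
  let ?R = "hex_region \<delta> D" and ?e = "entry_vertex \<delta> D a"
  have e: "endpoint \<delta> a ?e" "?e \<in> ?R"
    using theI'[OF assms(6)] unfolding entry_vertex_def by blast+
  have e_unique: "x = ?e" if "endpoint \<delta> a x" "x \<in> ?R" for x
    using assms(6) that e by blast
  have ne: "a \<noteq> b" using assms(4,8) by blast
  have w: "polygonal_path \<delta> \<omega>" "distinct \<omega>" using assms(10) by (auto simp: simple_polygonal_path_def)
  have wne: "\<omega> \<noteq> []" using w(1) by (simp add: polygonal_path_def)
  have wR: "path_trace \<omega> \<subseteq> ?R \<union> closed_segment a ?e" using assms(13) by (simp add: entry_half_edge_def)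
  have lat: "lattice_pt x" if "x \<in> set \<omega>" for x
    using polygonal_path_lattice[OF w(1) _ that] assms(3,11) by (simp add: lattice_pt_def)
  \<comment> \<open>From \<open>a\<close>, connections stay in the domain and end at
    \<open>b\<close>, so two of them can be joined there.\<close>
  interpret F: hex_walk \<delta> D ?R b \<omega>
  proof unfold_locales
    fix n assume n: "2 \<le> n" "n < length \<omega>"
    show "path_trace (drop n \<omega>) \<subseteq> ?R"
    proof (rule path_trace_avoiding_whisker[OF e])
      show "successively (half_edge \<delta>) (drop n \<omega>)"
        using w(1) successively_take_drop(2) unfolding polygonal_path_def by blast
      show "lattice_pt x" if "x \<in> set (drop n \<omega>)" for x using that lat in_set_dropD by metis
      \<comment> \<open>A simple path does not return to \<open>a\<close>, so its tail no longer
        uses the half-edge outside the domain.\<close>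
      have "a \<in> set (take n \<omega>)" using assms(11) wne n by (cases \<omega>; cases n) auto
      then show "a \<notin> set (drop n \<omega>)" using set_take_disj_set_drop_if_distinct[OF w(2), of n n] by auto
      show "path_trace (drop n \<omega>) \<subseteq> ?R \<union> closed_segment a ?e" using path_trace_drop_subset wR by blast
    qed
  next
    fix v m1 m2 q1 q2
    assume q: "polygonal_path \<delta> q1" "hd q1 = m1" "last q1 = b" "path_trace q1 \<subseteq> ?R"
      "polygonal_path \<delta> q2" "hd q2 = m2" "last q2 = b" "path_trace q2 \<subseteq> ?R"
    have r: "polygonal_path \<delta> (rev q2)" using q(5) by (simp add: polygonal_path_rev)
    have "q2 \<noteq> []" using q(5) by (simp add: polygonal_path_def)
    then have hl: "hd (rev q2) = b" "last (rev q2) = m2" using q(6,7) by (simp_all add: hd_rev last_rev)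
    have "last q1 = hd (rev q2)" using q(3) hl by simp
    note j = polygonal_path_join[OF q(1) r this]
    show "\<exists>q. polygonal_path \<delta> q \<and> hd q = m1 \<and> last q = m2 \<and> set q \<subseteq> set q1 \<union> set q2 \<and> path_trace q \<subseteq> ?R"
      using j q hl by (intro exI[of _ "q1 @ tl (rev q2)"]) (simp add: path_trace_rev)
  qed (use assms w in auto)
  \<comment> \<open>From \<open>b\<close>, connections leave the domain just before
    \<open>a\<close>. To keep the joined path inside, both are cut at the entry vertex.\<close>
  interpret B: hex_walk \<delta> D "?R \<union> closed_segment a ?e" a "rev \<omega>"
  proof unfold_locales
    fix n
    show "path_trace (drop n (rev \<omega>)) \<subseteq> ?R \<union> closed_segment a ?e"
      using path_trace_drop_subset[of n "rev \<omega>"] wR by (simp add: path_trace_rev)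
  next
    fix v m1 m2 q1 q2
    assume m: "endpoint \<delta> m1 v" "endpoint \<delta> m2 v" "m1 \<noteq> m2" "v \<in> set (rev \<omega>)"
      and q: "polygonal_path \<delta> q1" "hd q1 = m1" "last q1 = a" "path_trace q1 \<subseteq> ?R \<union> closed_segment a ?e" "v \<notin> set q1"
        "polygonal_path \<delta> q2" "hd q2 = m2" "last q2 = a" "path_trace q2 \<subseteq> ?R \<union> closed_segment a ?e" "v \<notin> set q2"
    have latm: "lattice_pt m1" "lattice_pt m2" using endpoint_mid_edge m by (auto simp: lattice_pt_def)
    have trim: "\<exists>q'. polygonal_path \<delta> q' \<and> hd q' = hd q \<and> last q' = ?e \<and> set q' \<subseteq> set q \<and> path_trace q' \<subseteq> ?R"
      if "polygonal_path \<delta> q" "lattice_pt (hd q)" "hd q \<noteq> a" "last q = a" "path_trace q \<subseteq> ?R \<union> closed_segment a ?e" for q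
      using path_to_entry_vertex[OF e e_unique that] .
    have va: "v = ?e" if "endpoint \<delta> a v"
    proof -
      have "v \<in> ?R \<union> closed_segment a ?e" using m(4) set_subset_path_trace[of \<omega>] wR by auto
      then show ?thesis using endpoint_in_region_whisker[OF e(1) e_unique that] by blast
    qed
    \<comment> \<open>Any path to \<open>a\<close> from elsewhere passes through the entry vertex,
      so none avoids \<open>v\<close> if \<open>v\<close> is that vertex. Hence \<open>a\<close>
      cannot be one of two competing moves.\<close>
    have contra: "\<not> (v = ?e \<and> hd q \<noteq> a)"
      if q': "polygonal_path \<delta> q" "lattice_pt (hd q)" "last q = a" "path_trace q \<subseteq> ?R \<union> closed_segment a ?e" "v \<notin> set q" for q
    proof
      assume v: "v = ?e \<and> hd q \<noteq> a"
      then obtain q' where "polygonal_path \<delta> q'" "last q' = ?e" "set q' \<subseteq> set q" using trim[OF q'(1,2) _ q'(3,4)] by blast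
      then show False using v q'(5) by (metis last_in_set polygonal_path_def subsetD)
    qed
    have "m1 \<noteq> a" using contra[of q2] q latm m va by metis
    moreover have "m2 \<noteq> a" using contra[of q1] q latm m va by metis
    ultimately obtain p1 p2 where p: "polygonal_path \<delta> p1" "hd p1 = m1" "last p1 = ?e" "set p1 \<subseteq> set q1" "path_trace p1 \<subseteq> ?R"
      "polygonal_path \<delta> p2" "hd p2 = m2" "last p2 = ?e" "set p2 \<subseteq> set q2" "path_trace p2 \<subseteq> ?R"
      using trim[of q1] trim[of q2] q latm by metis
    have r: "polygonal_path \<delta> (rev p2)" using p(6) by (simp add: polygonal_path_rev)
    have "p2 \<noteq> []" using p(6) by (simp add: polygonal_path_def)
    then have hl: "hd (rev p2) = ?e" "last (rev p2) = m2" using p(7,8) by (simp_all add: hd_rev last_rev)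
    have "last p1 = hd (rev p2)" using p(3) hl by simp
    note j = polygonal_path_join[OF p(1) r this]
    show "\<exists>q. polygonal_path \<delta> q \<and> hd q = m1 \<and> last q = m2 \<and> set q \<subseteq> set q1 \<union> set q2 \<and> path_trace q \<subseteq> ?R"
      using j p hl by (intro exI[of _ "p1 @ tl (rev p2)"]) (auto simp: path_trace_rev)
  qed (use assms w wne in \<open>auto simp: polygonal_path_rev hd_rev last_rev\<close>)
  have steps: "1 \<le> F.steps" "B.steps = F.steps"
  proof -
    have "length \<omega> \<noteq> 1" using ne assms(11,12) by (auto simp: length_Suc_conv)
    then show "1 \<le> F.steps" using F.length_walk by (cases F.steps) auto
    show "B.steps = F.steps" using F.length_walk B.length_walk by simp
  qed
  have seen: "B.seen B.steps = F.seen F.steps" unfolding B.seen_steps F.seen_steps by simp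
  define l where "l = card (touched_hexagons \<delta> D \<omega>)"
  have l: "card (D \<inter> F.seen F.steps) = l" by (simp add: l_def F.touched_hexagons_eq)
  have Fv: "F.vert 0 = ?e"
  proof -
    have "endpoint \<delta> a (F.vert 0)" using F.endpoint_mid_vert(1)[of 0] steps F.hd_walk assms(11) by simp
    moreover have "F.vert 0 \<in> set \<omega>" using steps F.length_walk by (simp add: F.vert_def)
    then have "F.vert 0 \<in> ?R \<union> closed_segment a ?e" using set_subset_path_trace[of \<omega>] wR by auto
    ultimately show ?thesis using endpoint_in_region_whisker[OF e(1) e_unique] by blast
  qed
  have aD: "hexes_at a \<inter> D = {}" using assms(4) by (simp add: mem_hex_region)
  \<comment> \<open>A hexagon at \<open>a\<close> lies outside the domain and also at the entry
    vertex, so the class \<open>None\<close> is seen in both directions.\<close>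
  obtain h where h: "h \<in> hexes_at a" using card_hexes_mid_edge[OF assms(3)] by (metis all_not_in_conv card.empty zero_neq_numeral)
  have hseen: "h \<in> F.seen F.steps" "h \<notin> D"
  proof -
    have "h \<in> hexes_at (F.vert 0)" using h endpoint_hexes[OF e(1)] Fv by auto
    then show "h \<in> F.seen F.steps" using steps by (force simp: F.seen_def)
    show "h \<notin> D" using h aD by blast
  qed
  have "spmf (radial_exploration \<delta> D a b) \<omega> = (1 / 2) ^ l"
  proof -
    let ?S = "{m \<in> mid_edges \<delta>. m \<in> ?R \<and> dist m a \<le> \<delta>}"
    have m1: "endpoint \<delta> (F.mid 1) ?e" "F.mid 0 = a" "F.mid 1 \<noteq> a"
      using F.endpoint_mid_vert(2)[of 0] steps Fv F.hd_walk assms(11) F.mid_inj[of 0 1] by auto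
    obtain f where f: "f \<notin> hexes_at a" "hexes_at ?e = insert f (hexes_at a)" by (rule hexagon_ahead[OF e(1)])
    have fD: "f \<in> D" using e(2) f(2) aD by (auto simp: mem_hex_region)
    \<comment> \<open>Only one endpoint of \<open>a\<close> is in the domain, so first moves inside
      the domain turn at the entry vertex. Both other edges there border \<open>f\<close>, which
      belongs to \<open>D\<close>.\<close>
    have S: "?S = {n. endpoint \<delta> n ?e} - {a}"
    proof (intro equalityI subsetI)
      fix n assume n: "n \<in> ?S"
      then have "n \<noteq> a" using assms(4) by blast
      then obtain v where v: "endpoint \<delta> n v" "endpoint \<delta> a v" using n dist_mid_edges_iff assms(3) by blast
      have "v \<in> ?R" using half_edge_subset_region[OF v(1)] n by auto
      then have "v = ?e" using e_unique v by blast
      then show "n \<in> {n. endpoint \<delta> n ?e} - {a}" using v \<open>n \<noteq> a\<close> by blast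
    next
      fix n assume n: "n \<in> {n. endpoint \<delta> n ?e} - {a}"
      then have "n \<in> mid_edges \<delta>" "dist n a \<le> \<delta>" using endpoint_mid_edge dist_mid_edges_iff[of n a] assms(3) e(1) by auto
      moreover obtain L where "hexes_at n = {f, L}" by (rule mid_edge_ahead[OF e(1), of n f]) (use n f in auto)
      then have "n \<in> ?R" using fD by (auto simp: mem_hex_region)
      ultimately show "n \<in> ?S" by blast
    qed
    have cS: "finite ?S" "card ?S = 2"
    proof -
      have "card {n. endpoint \<delta> n ?e} = 3" by (rule card_star[OF endpoint_is_vertex[OF e(1)]])
      moreover from this have "finite {n. endpoint \<delta> n ?e}" by (intro card_ge_0_finite) simp
      ultimately show "finite ?S" "card ?S = 2" unfolding S using e(1) by simp_all
    qed
    have "F.mid 1 \<in> ?S" unfolding S using m1 by blast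
    have "\<omega> = [a, ?e, F.mid 1] @ drop 3 \<omega>" using F.walk_start steps m1 Fv by simp
    then have "spmf (radial_exploration \<delta> D a b) \<omega> = spmf (explore \<delta> ?R b [a, ?e, F.mid 1]) \<omega> / card ?S"
      unfolding radial_exploration_def by (rule spmf_explore_start[OF cS(1) \<open>F.mid 1 \<in> ?S\<close>])
    moreover have "spmf (explore \<delta> ?R b [a, ?e, F.mid 1]) \<omega> * 2 * 2 ^ l = 2 ^ card (hex_class D ` hexes_at ?e)"
      using F.spmf_from_start[OF steps(1) hseen] unfolding Fv m1(2) l .
    \<comment> \<open>Two classes are seen at the entry vertex, against two first moves.\<close>
    moreover have "hex_class D ` hexes_at ?e = {Some f, None}"
      unfolding f using aD fD h by (auto simp: hex_class_def)
    ultimately show ?thesis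
      using cS by (intro half_power_eq[of "spmf (explore \<delta> ?R b [a, ?e, F.mid 1]) \<omega>" l 1]) simp_all
  qed
  moreover have "spmf (reverse_radial_exploration \<delta> D a b) (rev \<omega>) = (1 / 2) ^ l"
  proof -
    let ?S = "{m \<in> mid_edges \<delta>. m \<noteq> b \<and> dist m b \<le> \<delta>}" and ?v = "B.vert 0" and ?m = "B.mid 1"
    have b0: "B.mid 0 = b" using B.hd_walk wne assms(12) by (simp add: hd_rev)
    have bv: "endpoint \<delta> b ?v" "endpoint \<delta> ?m ?v" "?m \<noteq> b"
      using B.endpoint_mid_vert[of 0] steps b0 B.mid_inj[of 0 1] by auto
    have cS: "card ?S = 4" by (rule card_neighbours[OF assms(7)])
    then have fS: "finite ?S" by (intro card_ge_0_finite) simp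
    have mS: "?m \<in> ?S" using bv endpoint_mid_edge dist_mid_edges_iff[of ?m b] by auto
    have cv: "common_endpoint \<delta> b ?m = ?v" using common_endpoint_eq bv by metis
    have "rev \<omega> = [b, common_endpoint \<delta> b ?m, ?m] @ drop 3 (rev \<omega>)" using B.walk_start steps b0 cv by simp
    then have "spmf (reverse_radial_exploration \<delta> D a b) (rev \<omega>) =
        spmf (explore \<delta> (?R \<union> closed_segment a ?e) a [b, common_endpoint \<delta> b ?m, ?m]) (rev \<omega>) / card ?S"
      unfolding reverse_radial_exploration_def entry_half_edge_def by (rule spmf_explore_start[OF fS mS])
    moreover have "spmf (explore \<delta> (?R \<union> closed_segment a ?e) a [b, ?v, ?m]) (rev \<omega>) * 2 * 2 ^ l = 2 ^ card (hex_class D ` hexes_at ?v)"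
      using B.spmf_from_start[of h] steps hseen unfolding b0 seen l by simp
    \<comment> \<open>The vertex is within \<open>\<delta> / 2\<close> of \<open>b\<close>, so its
      hexagons all belong to \<open>D\<close> and the outside is not yet seen: three classes against
      four first moves.\<close>
    moreover have "card (hex_class D ` hexes_at ?v) = 3"
    proof -
      have "k \<in> D" if "k \<in> hexes_at ?v" for k
        using assms(9)[of k] that dist_endpoint[OF bv(1)] assms(1) unfolding mem_hexes_at by fastforce
      then have "inj_on (hex_class D) (hexes_at ?v)" by (auto simp: inj_on_def hex_class_def)
      then show ?thesis using card_image card_hexes_vertex[OF endpoint_is_vertex[OF bv(1)]] by metis
    qed
    ultimately show ?thesis
      using cS cv by (intro half_power_eq[of "spmf (explore \<delta> (?R \<union> closed_segment a ?e) a [b, ?v, ?m]) (rev \<omega>)" l 2]) simp_all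
  qed
  ultimately show ?thesis by (simp add: l_def)
qed

end
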